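(* Let $\Omega\subset X$ be a nonempty bounded open set with $P(\Omega,X)<\infty$ such that for every $u\in \mathrm{BV}(\Omega)$ the trace $Tu(x)$ exists for $\mathcal H$-a.e. $x\in\partial^*\Omega$. Let $f\in L^1(\partial^*\Omega,P(\Omega,\cdot))$ satisfy $\int_{\partial^*\Omega} f\,dP(\Omega,\cdot)=0$. Let $E_1,E_2\subset\Omega$ be disjoint sets such that $\chi_{E_1}-\chi_{E_2}$ solves the restricted Neumann problem with boundary data $f$. Then $\chi_{E_1}$ and $\chi_{E_2}$ are functions of least gradient in $\Omega$.
   Context: Setting. $(X,d,\mu)$ is a complete metric space with at least two points, with a Borel regular outer measure $\mu$ that is doubling: there is $C_d\ge 1$ with $0<\mu(B(x,2r))\le C_d\,\mu(B(x,r))<\infty$ for all balls. A Borel function $g\ge 0$ is an upper gradient of $u$ if $|u(x)-u(y)|\le\int_\gamma g\,ds$ for every nonconstant rectifiable curve $\gamma$ with end points $x,y$ (the left side is $\infty$ if $u(x)$ or $u(y)$ is infinite); for functions on an open set $U$ only curves in $U$ are considered. $X$ supports a $(1,1)$-Poincaré inequality: there are $C_P>0$, $\lambda\ge 1$ such that for all balls $B(x,r)$, all locally integrable $u$ on $X$ and all upper gradients $g$ of $u$, $\frac1{\mu(B(x,r))}\int_{B(x,r)}|u-u_{B(x,r)}|\,d\mu\le \frac{C_P r}{\mu(B(x,\lambda r))}\int_{B(x,\lambda r)}g\,d\mu$, where $u_{B}$ is the mean of $u$ over $B$. BV functions. For $U\subset X$ open and $u\in L^1_{\rm loc}(U)$,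 $\|Du\|(U)=\inf\{\liminf_i\int_U g_{u_i}\,d\mu\}$, the infimum over $u_i\in \mathrm{Lip}_{\rm loc}(U)$ (Lipschitz on every open $U'$ with $\overline{U'}$ compact in $U$) with $u_i\to u$ in $L^1_{\rm loc}(U)$ and $g_{u_i}$ an upper gradient of $u_i$ in $U$; for arbitrary $A$, $\|Du\|(A)=\inf\{\|Du\|(U):U\supset A\text{ open}\}$. $u\in\mathrm{BV}(U)$ means $u\in L^1(U)$ and $\|Du\|(U)<\infty$; $\mathrm{BV}_{\rm loc}(U)$ is the corresponding local space (BV on every open $U'$ with $\overline{U'}$ compact in $U$). For $\mu$-measurable $E$, $P(E,A)=\|D\chi_E\|(A)$. A function $u\in\mathrm{BV}_{\rm loc}(\Omega)$ is of least gradient in $\Omega$ if $\|Du\|(\Omega)\le\|D(u+\varphi)\|(\Omega)$ for every $\varphi\in\mathrm{BV}(\Omega)$ with compact support in $\Omega$. $\mathcal H$ is the codimension 1 Hausdorff measure: $\mathcal H(A)=\lim_{R\to0}\inf\{\sum_i \mu(B(x_i,r_i))/r_i: A\subset\bigcup_i B(x_i,r_i),\ r_i\le R\}$. The measure theoretic boundary $\partial^*E$ is the set of $x\in X$ with $\limsup_{r\to0}\mu(B(x,r)\cap E)/\mu(B(x,r))>0$ and $\limsup_{r\to 0}\mu(B(x,r)\setminus E)/\mu(B(x,r))>0$. For $u$ on $\Omega$ and $x\in\partial\Omega$, the number $Tu(x)$ is the trace of $u$ at $x$ if $\lim_{r\to0}\frac{1}{\mu(B(x,r)\cap\Omega)}\int_{B(x,r)\cap\Omega}|u-Tu(x)|\,d\mu=0$.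 Functional: $I(u)=\|Du\|(\Omega)+\int_{\partial^*\Omega}Tu\,f\,dP(\Omega,\cdot)$ for $u\in\mathrm{BV}(\Omega)$. A function $u\in \mathrm{BV}(\Omega)$ solves the restricted Neumann problem with boundary data $f$ if $-1\le u\le1$ and $I(u)\le I(v)$ for all $v\in\mathrm{BV}(\Omega)$ with $-1\le v\le 1$. *)

theory Defs
  imports "HOL-Analysis.Analysis"
begin

section \<open>Metric measure spaces\<close>

text \<open>
  The space \<open>X\<close> is (the universe of) a type of class \<open>complete_space\<close>. Functions on a subset of \<open>X\<close>
  are total functions whose values outside the subset are never used. Balls are open.
\<close>

definition caratheodory_measure :: "('a set \<Rightarrow> ennreal) \<Rightarrow> 'a measure" where
  "caratheodory_measure \<nu> = measure_of UNIV (lambda_system UNIV (Pow UNIV) \<nu>) \<nu>"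

definition borel_regular_outer_measure :: "('a::topological_space set \<Rightarrow> ennreal) \<Rightarrow> bool" where
  "borel_regular_outer_measure \<mu> \<longleftrightarrow>
     outer_measure_space (Pow UNIV) \<mu> \<and>
     sets borel \<subseteq> lambda_system UNIV (Pow UNIV) \<mu> \<and>
     (\<forall>A. \<exists>B\<in>sets borel. A \<subseteq> B \<and> \<mu> B = \<mu> A)"

definition doubling :: "('a::metric_space set \<Rightarrow> ennreal) \<Rightarrow> bool" where
  "doubling \<mu> \<longleftrightarrow> (\<exists>C::real. 1 \<le> C \<and> (\<forall>x r. 0 < r \<longrightarrow>
     0 < \<mu> (ball x (2 * r)) \<and>
     \<mu> (ball x (2 * r)) \<le> ennreal C * \<mu> (ball x r) \<and>
     ennreal C * \<mu> (ball x r) < \<infinity>))"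

definition compactly_inside :: "'a::topological_space set \<Rightarrow> 'a set \<Rightarrow> bool" where
  "compactly_inside V U \<longleftrightarrow> open V \<and> compact (closure V) \<and> closure V \<subseteq> U"

section \<open>Curves and upper gradients\<close>

text \<open>Curves are parametrized on the unit interval.\<close>

definition curve_length :: "(real \<Rightarrow> 'a::metric_space) \<Rightarrow> real \<Rightarrow> real \<Rightarrow> ennreal" where
  "curve_length \<gamma> a b =
     (SUP (t, n) \<in> {(t :: nat \<Rightarrow> real, n :: nat). mono t \<and> range t \<subseteq> {a..b}}.
        \<Sum>i<n. ennreal (dist (\<gamma> (t i)) (\<gamma> (t (Suc i)))))"

definition rectifiable_curve :: "(real \<Rightarrow> 'a::metric_space) \<Rightarrow> bool" where
  "rectifiable_curve \<gamma> \<longleftrightarrow> path \<gamma> \<and> curve_length \<gamma> 0 1 < \<infinity>"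

text \<open>The value does not depend on the choice of \<open>t\<close>: a curve is constant on any parameter interval
  on which the length of its initial part is constant.\<close>

definition arc_length_param :: "(real \<Rightarrow> 'a::metric_space) \<Rightarrow> real \<Rightarrow> 'a" where
  "arc_length_param \<gamma> s = \<gamma> (SOME t. t \<in> {0..1} \<and> curve_length \<gamma> 0 t = ennreal s)"

definition line_integral :: "('a::metric_space \<Rightarrow> ennreal) \<Rightarrow> (real \<Rightarrow> 'a) \<Rightarrow> ennreal" where
  "line_integral g \<gamma> =
     (\<integral>\<^sup>+ s \<in> {0..enn2real (curve_length \<gamma> 0 1)}. g (arc_length_param \<gamma> s) \<partial>lborel)"

text \<open>In \<open>ereal\<close> the absolute value of a difference with an infinite term is \<open>\<infinity>\<close>, including
  \<open>\<infinity> - \<infinity>\<close>, which is the required convention for the left-hand side.\<close>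

definition upper_gradient ::
    "'a::metric_space set \<Rightarrow> ('a \<Rightarrow> ennreal) \<Rightarrow> ('a \<Rightarrow> ereal) \<Rightarrow> bool" where
  "upper_gradient U g u \<longleftrightarrow>
     g \<in> borel_measurable (restrict_space borel U) \<and>
     (\<forall>\<gamma>. rectifiable_curve \<gamma> \<and> path_image \<gamma> \<subseteq> U \<and> \<not> \<gamma> constant_on {0..1} \<longrightarrow>
        e2ennreal \<bar>u (pathstart \<gamma>) - u (pathfinish \<gamma>)\<bar> \<le> line_integral g \<gamma>)"

lemma ereal_abs_diff_infinite:
  fixes a b :: ereal
  assumes "\<bar>a\<bar> = \<infinity> \<or> \<bar>b\<bar> = \<infinity>"
  shows "\<bar>a - b\<bar> = \<infinity>"
  using assms by (cases a; cases b) auto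

section \<open>Poincare inequality\<close>

definition locally_integrable_ereal ::
    "('a::metric_space set \<Rightarrow> ennreal) \<Rightarrow> ('a \<Rightarrow> ereal) \<Rightarrow> bool" where
  "locally_integrable_ereal \<mu> u \<longleftrightarrow>
     u \<in> borel_measurable (caratheodory_measure \<mu>) \<and>
     (\<forall>V. compactly_inside V UNIV \<longrightarrow>
        (\<integral>\<^sup>+ x \<in> V. e2ennreal \<bar>u x\<bar> \<partial>caratheodory_measure \<mu>) < \<infinity>)"

text \<open>A locally integrable extended real function is finite almost everywhere, so the choice
  \<open>real_of_ereal \<infinity> = 0\<close> does not affect the mean.\<close>

definition mean_on :: "('a set \<Rightarrow> ennreal) \<Rightarrow> 'a set \<Rightarrow> ('a \<Rightarrow> ereal) \<Rightarrow> real" where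
  "mean_on \<mu> B u = (LINT x:B|caratheodory_measure \<mu>. real_of_ereal (u x)) / enn2real (\<mu> B)"

definition poincare_1_1 :: "('a::metric_space set \<Rightarrow> ennreal) \<Rightarrow> bool" where
  "poincare_1_1 \<mu> \<longleftrightarrow> (\<exists>C l::real. 0 < C \<and> 1 \<le> l \<and>
     (\<forall>x r u g. 0 < r \<and> locally_integrable_ereal \<mu> u \<and> upper_gradient UNIV g u \<longrightarrow>
        (\<integral>\<^sup>+ y \<in> ball x r. e2ennreal \<bar>u y - ereal (mean_on \<mu> (ball x r) u)\<bar>
             \<partial>caratheodory_measure \<mu>) / \<mu> (ball x r)
        \<le> ennreal (C * r) / \<mu> (ball x (l * r)) *
           (\<integral>\<^sup>+ y \<in> ball x (l * r). g y \<partial>caratheodory_measure \<mu>)))"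

section \<open>Functions of bounded variation\<close>

definition L1_on :: "('a set \<Rightarrow> ennreal) \<Rightarrow> 'a set \<Rightarrow> ('a \<Rightarrow> real) \<Rightarrow> bool" where
  "L1_on \<mu> U u \<longleftrightarrow> set_integrable (caratheodory_measure \<mu>) U u"

definition lip_loc :: "'a::metric_space set \<Rightarrow> ('a \<Rightarrow> real) \<Rightarrow> bool" where
  "lip_loc U u \<longleftrightarrow> (\<forall>V. compactly_inside V U \<longrightarrow> (\<exists>C. C-lipschitz_on V u))"

definition L1_loc_tendsto ::
    "('a::metric_space set \<Rightarrow> ennreal) \<Rightarrow> 'a set \<Rightarrow> (nat \<Rightarrow> 'a \<Rightarrow> real) \<Rightarrow> ('a \<Rightarrow> real) \<Rightarrow> bool" where
  "L1_loc_tendsto \<mu> U v u \<longleftrightarrow> (\<forall>V. compactly_inside V U \<longrightarrow>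
     (\<lambda>i. \<integral>\<^sup>+ x \<in> V. ennreal \<bar>v i x - u x\<bar> \<partial>caratheodory_measure \<mu>) \<longlonglongrightarrow> 0)"

text \<open>The total variation of \<open>u\<close> in an open set \<open>U\<close>, for \<open>u\<close> locally integrable in \<open>U\<close>.\<close>

definition total_variation ::
    "('a::metric_space set \<Rightarrow> ennreal) \<Rightarrow> 'a set \<Rightarrow> ('a \<Rightarrow> real) \<Rightarrow> ennreal" where
  "total_variation \<mu> U u =
     Inf {liminf (\<lambda>i. \<integral>\<^sup>+ x \<in> U. g i x \<partial>caratheodory_measure \<mu>) | v g.
            (\<forall>i. lip_loc U (v i)) \<and> L1_loc_tendsto \<mu> U v u \<and>
            (\<forall>i. upper_gradient U (g i) (\<lambda>x. ereal (v i x)))}"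

definition BV :: "('a::metric_space set \<Rightarrow> ennreal) \<Rightarrow> 'a set \<Rightarrow> ('a \<Rightarrow> real) set" where
  "BV \<mu> U = {u. L1_on \<mu> U u \<and> total_variation \<mu> U u < \<infinity>}"

definition BV_loc :: "('a::metric_space set \<Rightarrow> ennreal) \<Rightarrow> 'a set \<Rightarrow> ('a \<Rightarrow> real) set" where
  "BV_loc \<mu> U = {u. \<forall>V. compactly_inside V U \<longrightarrow> u \<in> BV \<mu> V}"

definition perimeter ::
    "('a::metric_space set \<Rightarrow> ennreal) \<Rightarrow> 'a set \<Rightarrow> 'a set \<Rightarrow> ennreal" where
  "perimeter \<mu> E A = Inf {total_variation \<mu> U (indicator E) | U. open U \<and> A \<subseteq> U}"

text \<open>The perimeter as a (complete) measure. All Borel sets are Caratheodory measurable when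
  \<open>E\<close> has finite perimeter.\<close>

definition perimeter_measure ::
    "('a::metric_space set \<Rightarrow> ennreal) \<Rightarrow> 'a set \<Rightarrow> 'a measure" where
  "perimeter_measure \<mu> E = caratheodory_measure (perimeter \<mu> E)"

definition least_gradient ::
    "('a::metric_space set \<Rightarrow> ennreal) \<Rightarrow> 'a set \<Rightarrow> ('a \<Rightarrow> real) \<Rightarrow> bool" where
  "least_gradient \<mu> \<Omega> u \<longleftrightarrow> u \<in> BV_loc \<mu> \<Omega> \<and>
     (\<forall>\<phi>\<in>BV \<mu> \<Omega>. compact (closure {x\<in>\<Omega>. \<phi> x \<noteq> 0}) \<and> closure {x\<in>\<Omega>. \<phi> x \<noteq> 0} \<subseteq> \<Omega> \<longrightarrow>
        total_variation \<mu> \<Omega> u \<le> total_variation \<mu> \<Omega> (\<lambda>x. u x + \<phi> x))"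

section \<open>Codimension one Hausdorff measure, measure theoretic boundary, traces\<close>

text \<open>The index set \<open>I\<close> admits finite as well as countably infinite covers.\<close>

definition codim1_content ::
    "('a::metric_space set \<Rightarrow> ennreal) \<Rightarrow> real \<Rightarrow> 'a set \<Rightarrow> ennreal" where
  "codim1_content \<mu> R A =
     Inf {(\<integral>\<^sup>+ i. \<mu> (ball (x i) (r i)) / ennreal (r i) \<partial>count_space I) |
            (x :: nat \<Rightarrow> 'a) (r :: nat \<Rightarrow> real) (I :: nat set).
            A \<subseteq> (\<Union>i\<in>I. ball (x i) (r i)) \<and> (\<forall>i\<in>I. 0 < r i \<and> r i \<le> R)}"

definition codim1_hausdorff :: "('a::metric_space set \<Rightarrow> ennreal) \<Rightarrow> 'a set \<Rightarrow> ennreal" where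
  "codim1_hausdorff \<mu> A = Lim (at_right 0) (\<lambda>R. codim1_content \<mu> R A)"

definition mt_boundary :: "('a::metric_space set \<Rightarrow> ennreal) \<Rightarrow> 'a set \<Rightarrow> 'a set" where
  "mt_boundary \<mu> E = {x.
     0 < Limsup (at_right 0) (\<lambda>r. \<mu> (ball x r \<inter> E) / \<mu> (ball x r)) \<and>
     0 < Limsup (at_right 0) (\<lambda>r. \<mu> (ball x r - E) / \<mu> (ball x r))}"

definition has_trace ::
    "('a::metric_space set \<Rightarrow> ennreal) \<Rightarrow> 'a set \<Rightarrow> ('a \<Rightarrow> real) \<Rightarrow> 'a \<Rightarrow> real \<Rightarrow> bool" where
  "has_trace \<mu> \<Omega> u x T \<longleftrightarrow>
     ((\<lambda>r. (\<integral>\<^sup>+ y \<in> ball x r \<inter> \<Omega>. ennreal \<bar>u y - T\<bar> \<partial>caratheodory_measure \<mu>)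
            / \<mu> (ball x r \<inter> \<Omega>)) \<longlongrightarrow> 0) (at_right 0)"

text \<open>At boundary points of an open set \<open>\<Omega>\<close> the trace is unique if it exists.\<close>

definition trace ::
    "('a::metric_space set \<Rightarrow> ennreal) \<Rightarrow> 'a set \<Rightarrow> ('a \<Rightarrow> real) \<Rightarrow> 'a \<Rightarrow> real" where
  "trace \<mu> \<Omega> u x = (THE T. has_trace \<mu> \<Omega> u x T)"

section \<open>The restricted Neumann problem\<close>

definition neumann_functional ::
    "('a::metric_space set \<Rightarrow> ennreal) \<Rightarrow> 'a set \<Rightarrow> ('a \<Rightarrow> real) \<Rightarrow> ('a \<Rightarrow> real) \<Rightarrow> real" where
  "neumann_functional \<mu> \<Omega> f u =
     enn2real (total_variation \<mu> \<Omega> u) +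
     (LINT x:mt_boundary \<mu> \<Omega>|perimeter_measure \<mu> \<Omega>. trace \<mu> \<Omega> u x * f x)"

definition solves_restricted_neumann ::
    "('a::metric_space set \<Rightarrow> ennreal) \<Rightarrow> 'a set \<Rightarrow> ('a \<Rightarrow> real) \<Rightarrow> ('a \<Rightarrow> real) \<Rightarrow> bool" where
  "solves_restricted_neumann \<mu> \<Omega> f u \<longleftrightarrow>
     u \<in> BV \<mu> \<Omega> \<and> (\<forall>x\<in>\<Omega>. -1 \<le> u x \<and> u x \<le> 1) \<and>
     (\<forall>v\<in>BV \<mu> \<Omega>. (\<forall>x\<in>\<Omega>. -1 \<le> v x \<and> v x \<le> 1) \<longrightarrow>
        neumann_functional \<mu> \<Omega> f u \<le> neumann_functional \<mu> \<Omega> f v)"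

end

theory Submission
  imports Defs
begin

text \<open>
  Let \<open>u = \<chi>\<^sub>1 - \<chi>\<^sub>2\<close> be the solution and \<open>\<phi>\<close> a perturbation with compact support in \<open>\<Omega>\<close>. Truncating
  \<open>\<chi>\<^sub>1 + \<phi>\<close> to values in \<open>[0,1]\<close> gives \<open>t\<close> with \<open>\<parallel>Dt\<parallel> \<le> \<parallel>D(\<chi>\<^sub>1 + \<phi>)\<parallel>\<close>, and \<open>v = t - \<chi>\<^sub>2\<close> is
  admissible for the Neumann problem. It agrees with \<open>u\<close> near \<open>\<partial>\<Omega>\<close>, so the traces coincide and
  minimality reads \<open>\<parallel>Du\<parallel> \<le> \<parallel>Dv\<parallel> \<le> \<parallel>Dt\<parallel> + \<parallel>D\<chi>\<^sub>2\<parallel>\<close>. Conversely \<open>\<parallel>D\<chi>\<^sub>1\<parallel> + \<parallel>D\<chi>\<^sub>2\<parallel> \<le> \<parallel>Du\<parallel>\<close>: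
  if \<open>g\<close> is an upper gradient of a continuous \<open>w\<close>, then \<open>g\<close> restricted to \<open>{w > 0}\<close> is an upper
  gradient of the positive part of \<open>w\<close> (follow a curve until it first leaves \<open>{w > 0}\<close>), and
  likewise for the negative part. Cancelling \<open>\<parallel>D\<chi>\<^sub>2\<parallel>\<close> gives the claim for \<open>\<chi>\<^sub>1\<close>; the claim for
  \<open>\<chi>\<^sub>2\<close> is the same statement for \<open>-u\<close>.
\<close>

section \<open>Curve length and line integrals\<close>

lemma curve_length_upper:
  assumes "mono t" "range t \<subseteq> {a..b}"
  shows "(\<Sum>i<n. ennreal (dist (\<gamma> (t i)) (\<gamma> (t (Suc i))))) \<le> curve_length \<gamma> a b"
  unfolding curve_length_def
  by (rule SUP_upper2[where i = "(t, n)"]) (use assms in auto)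

lemma curve_length_least:
  assumes "\<And>t n. mono t \<Longrightarrow> range t \<subseteq> {a..b} \<Longrightarrow>
    (\<Sum>i<n. ennreal (dist (\<gamma> (t i)) (\<gamma> (t (Suc i))))) \<le> c"
  shows "curve_length \<gamma> a b \<le> c"
  unfolding curve_length_def by (rule SUP_least) (use assms in auto)

lemma curve_length_mono:
  assumes "a \<le> a'" "b' \<le> b"
  shows "curve_length \<gamma> a' b' \<le> curve_length \<gamma> a b"
  by (rule curve_length_least, rule curve_length_upper) (use assms in fastforce)+

lemma dist_le_curve_length:
  assumes "a \<le> b"
  shows "ennreal (dist (\<gamma> a) (\<gamma> b)) \<le> curve_length \<gamma> a b"
proof -
  have "(\<Sum>i<1. ennreal (dist (\<gamma> ((\<lambda>i::nat. if i = 0 then a else b) i))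
      (\<gamma> ((\<lambda>i::nat. if i = 0 then a else b) (Suc i))))) \<le> curve_length \<gamma> a b"
    by (rule curve_length_upper) (use assms in \<open>auto simp: mono_def\<close>)
  then show ?thesis by simp
qed

text \<open>A partition of [a,b] followed by a partition of [b,c] is a partition of [a,c]. The two
  sums are taken over independent partitions, so both suprema can be pulled out of the sum one after
  the other.\<close>

lemma curve_length_superadd:
  assumes "a \<le> b" "b \<le> c"
  shows "curve_length \<gamma> a b + curve_length \<gamma> b c \<le> curve_length \<gamma> a c"
proof -
  define S where "S t n = (\<Sum>i<n. ennreal (dist (\<gamma> (t i)) (\<gamma> (t (Suc i)))))"
    for t :: "nat \<Rightarrow> real" and n
  have key: "S t n + S s m \<le> curve_length \<gamma> a c"
    if t: "mono t" "range t \<subseteq> {a..b}" and s: "mono s" "range s \<subseteq> {b..c}" for t s n m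
  proof -
    \<comment> \<open>A sum of \<open>n\<close> terms uses the points \<open>t 0\<close> to
      \<open>t n\<close>, so \<open>s\<close> begins at index \<open>Suc n\<close>. The additional
      term joining \<open>t n\<close> to \<open>s 0\<close> is nonnegative and is dropped.\<close>
    define r where "r i = (if i \<le> n then t i else s (i - Suc n))" for i
    have tb: "a \<le> t i" "t i \<le> b" and sb: "b \<le> s i" "s i \<le> c" for i
      using range_subsetD[OF t(2)] range_subsetD[OF s(2)] by (meson atLeastAtMost_iff)+
    have "mono r"
    proof (rule monoI)
      fix i j :: nat assume "i \<le> j"
      show "r i \<le> r j"
        using \<open>i \<le> j\<close> monoD[OF t(1), of i j] monoD[OF s(1), of "i - Suc n" "j - Suc n"]
          order_trans[OF tb(2)[of i] sb(1)]
        by (auto simp: r_def)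
    qed
    moreover have "range r \<subseteq> {a..c}"
    proof clarify
      fix i show "r i \<in> {a..c}"
        using tb[of i] sb[of "i - Suc n"] assms by (simp add: r_def)
    qed
    ultimately have "S r (Suc n + m) \<le> curve_length \<gamma> a c"
      unfolding S_def by (rule curve_length_upper)
    moreover have "S t n + S s m \<le> S r (Suc n + m)"
    proof -
      have split: "{..<Suc n + m} = {..<n} \<union> {n} \<union> {Suc n..<Suc n + m}"
        by auto
      have "S r (Suc n + m) = (\<Sum>i<n. ennreal (dist (\<gamma> (r i)) (\<gamma> (r (Suc i)))))
          + ennreal (dist (\<gamma> (r n)) (\<gamma> (r (Suc n))))
          + (\<Sum>i\<in>{Suc n..<Suc n + m}. ennreal (dist (\<gamma> (r i)) (\<gamma> (r (Suc i)))))"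
        unfolding S_def split by (subst sum.union_disjoint; (subst sum.union_disjoint)?) auto
      also have "(\<Sum>i\<in>{Suc n..<Suc n + m}. ennreal (dist (\<gamma> (r i)) (\<gamma> (r (Suc i))))) = S s m"
        unfolding S_def
        by (rule sum.reindex_bij_witness[where i = "\<lambda>i. i + Suc n" and j = "\<lambda>i. i - Suc n"])
          (auto simp: r_def Suc_diff_Suc)
      also have "(\<Sum>i<n. ennreal (dist (\<gamma> (r i)) (\<gamma> (r (Suc i))))) = S t n"
        unfolding S_def by (rule sum.cong) (auto simp: r_def)
      finally show ?thesis by (simp add: add_right_mono)
    qed
    ultimately show ?thesis by simp
  qed
  have ne: "{(t :: nat \<Rightarrow> real, n :: nat). mono t \<and> range t \<subseteq> {x..y}} \<noteq> {}" if "x \<le> y" for x y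
    using that by (auto simp: mono_def intro!: exI[of _ "\<lambda>_. x"])
  have "curve_length \<gamma> a b + S s m \<le> curve_length \<gamma> a c"
    if s: "mono s" "range s \<subseteq> {b..c}" for s m
    unfolding curve_length_def[of \<gamma> a b]
    by (subst ennreal_SUP_add_left[OF ne[OF assms(1)], symmetric], rule SUP_least)
      (use key s in \<open>auto simp: S_def\<close>)
  then show ?thesis
    unfolding curve_length_def[of \<gamma> b c]
    by (subst ennreal_SUP_add_right[OF ne[OF assms(2)]], intro SUP_least)
      (auto simp: S_def)
qed

text \<open>The cut-off sequences \<open>min (t i) b\<close> and \<open>max (t i) b\<close> are
  again monotone, so no point has to be inserted. A step on one side of \<open>b\<close> is kept by
  one of them and made trivial by the other; a step across \<open>b\<close> is split by the triangle
  inequality.\<close>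

lemma curve_length_subadd:
  assumes "a \<le> b" "b \<le> c"
  shows "curve_length \<gamma> a c \<le> curve_length \<gamma> a b + curve_length \<gamma> b c"
proof (rule curve_length_least)
  fix t :: "nat \<Rightarrow> real" and n
  assume t: "mono t" "range t \<subseteq> {a..c}"
  have "ennreal (dist (\<gamma> (t i)) (\<gamma> (t (Suc i)))) \<le>
     ennreal (dist (\<gamma> (min (t i) b)) (\<gamma> (min (t (Suc i)) b))) +
     ennreal (dist (\<gamma> (max (t i) b)) (\<gamma> (max (t (Suc i)) b)))" for i
  proof -
    have "t i \<le> t (Suc i)" using t(1) by (simp add: mono_def)
    then have "dist (\<gamma> (t i)) (\<gamma> (t (Suc i))) \<le>
      dist (\<gamma> (min (t i) b)) (\<gamma> (min (t (Suc i)) b)) +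
      dist (\<gamma> (max (t i) b)) (\<gamma> (max (t (Suc i)) b))"
      by (auto simp: min_def max_def dist_triangle)
    then show ?thesis
      by (simp add: ennreal_plus[symmetric] del: ennreal_plus)
  qed
  then have "(\<Sum>i<n. ennreal (dist (\<gamma> (t i)) (\<gamma> (t (Suc i))))) \<le>
     (\<Sum>i<n. ennreal (dist (\<gamma> (min (t i) b)) (\<gamma> (min (t (Suc i)) b)))) +
     (\<Sum>i<n. ennreal (dist (\<gamma> (max (t i) b)) (\<gamma> (max (t (Suc i)) b))))"
    by (subst sum.distrib[symmetric]) (rule sum_mono)
  also have "\<dots> \<le> curve_length \<gamma> a b + curve_length \<gamma> b c"
  proof (rule add_mono)
    have tb: "a \<le> t i" "t i \<le> c" for i
      using range_subsetD[OF t(2)] by (meson atLeastAtMost_iff)+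
    show "(\<Sum>i<n. ennreal (dist (\<gamma> (min (t i) b)) (\<gamma> (min (t (Suc i)) b)))) \<le> curve_length \<gamma> a b"
      by (rule curve_length_upper[of "\<lambda>i. min (t i) b"])
        (use tb assms in \<open>auto intro!: monoI min.mono monoD[OF t(1)]\<close>)
    show "(\<Sum>i<n. ennreal (dist (\<gamma> (max (t i) b)) (\<gamma> (max (t (Suc i)) b)))) \<le> curve_length \<gamma> b c"
      by (rule curve_length_upper[of "\<lambda>i. max (t i) b"])
        (use tb assms in \<open>auto intro!: monoI max.mono monoD[OF t(1)]\<close>)
  qed
  finally show "(\<Sum>i<n. ennreal (dist (\<gamma> (t i)) (\<gamma> (t (Suc i)))))
     \<le> curve_length \<gamma> a b + curve_length \<gamma> b c" .
qed

lemma curve_length_add: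
  assumes "a \<le> b" "b \<le> c"
  shows "curve_length \<gamma> a b + curve_length \<gamma> b c = curve_length \<gamma> a c"
  using curve_length_superadd[OF assms] curve_length_subadd[OF assms] by (rule antisym)

text \<open>For a fixed partition the sum depends continuously on the partition points. Clamping a
  partition of [a,b] to the intervals from \<open>a' k\<close> to \<open>b' k\<close> gives
  partitions that converge to it, each with sum at most \<open>c\<close>.\<close>

lemma curve_length_lsc:
  assumes \<gamma>: "continuous_on {l..u} \<gamma>"
    and ab: "a' \<longlonglongrightarrow> a" "b' \<longlonglongrightarrow> b" "\<And>k. l \<le> a' k" "\<And>k. a' k \<le> b' k" "\<And>k. b' k \<le> u"
    and le: "\<And>k. curve_length \<gamma> (a' k) (b' k) \<le> c"
  shows "curve_length \<gamma> a b \<le> c"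
proof (rule curve_length_least)
  fix t :: "nat \<Rightarrow> real" and n
  assume t: "mono t" "range t \<subseteq> {a..b}"
  define s where "s k i = max (a' k) (min (t i) (b' k))" for k i
  have tb: "a \<le> t i" "t i \<le> b" for i
      using range_subsetD[OF t(2)] by (meson atLeastAtMost_iff)+
  have la: "l \<le> a" by (rule LIMSEQ_le_const[OF ab(1)]) (use ab in auto)
  have bu: "b \<le> u" by (rule LIMSEQ_le_const2[OF ab(2)]) (use ab in auto)
  have s_in: "s k i \<in> {a' k..b' k}" for k i
    using ab(4) by (auto simp: s_def)
  have "(\<lambda>k. s k i) \<longlonglongrightarrow> max a (min (t i) b)" for i
    unfolding s_def by (intro tendsto_max tendsto_min tendsto_const ab)
  then have lim: "(\<lambda>k. s k i) \<longlonglongrightarrow> t i" for i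
    using tb by (simp add: min_absorb1 max_absorb2)
  have "(\<lambda>k. \<gamma> (s k i)) \<longlonglongrightarrow> \<gamma> (t i)" for i
  proof (rule continuous_on_tendsto_compose[OF \<gamma> lim])
    show "t i \<in> {l..u}" using tb[of i] la bu by auto
    show "\<forall>\<^sub>F k in sequentially. s k i \<in> {l..u}"
    proof (intro always_eventually allI)
      fix k show "s k i \<in> {l..u}"
        using s_in[of k i] ab(3)[of k] ab(5)[of k] by simp
    qed
  qed
  then have "(\<lambda>k. \<Sum>i<n. ennreal (dist (\<gamma> (s k i)) (\<gamma> (s k (Suc i)))))
     \<longlonglongrightarrow> (\<Sum>i<n. ennreal (dist (\<gamma> (t i)) (\<gamma> (t (Suc i)))))"
    by (intro tendsto_sum tendsto_ennrealI tendsto_dist)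
  moreover have "(\<Sum>i<n. ennreal (dist (\<gamma> (s k i)) (\<gamma> (s k (Suc i))))) \<le> c" for k
  proof (rule order_trans[OF curve_length_upper le[of k]])
    show "mono (s k)"
      unfolding s_def by (intro monoI max.mono min.mono monoD[OF t(1)] order_refl)
    show "range (s k) \<subseteq> {a' k..b' k}" using s_in by auto
  qed
  ultimately show "(\<Sum>i<n. ennreal (dist (\<gamma> (t i)) (\<gamma> (t (Suc i))))) \<le> c"
    using LIMSEQ_le_const2 by blast
qed

lemma curve_length_comp_le:
  assumes "mono h"
  shows "curve_length (\<gamma> \<circ> h) a b \<le> curve_length \<gamma> (h a) (h b)"
proof (rule curve_length_least)
  fix t :: "nat \<Rightarrow> real" and n
  assume t: "mono t" "range t \<subseteq> {a..b}"
  have "(\<Sum>i<n. ennreal (dist (\<gamma> ((h \<circ> t) i)) (\<gamma> ((h \<circ> t) (Suc i))))) \<le> curve_length \<gamma> (h a) (h b)"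
    by (rule curve_length_upper)
      (use t assms in \<open>auto simp: mono_def image_subset_iff\<close>)
  then show "(\<Sum>i<n. ennreal (dist ((\<gamma> \<circ> h) (t i)) ((\<gamma> \<circ> h) (t (Suc i)))))
     \<le> curve_length \<gamma> (h a) (h b)" by simp
qed

text \<open>Rescaled to the unit interval, since \<open>rectifiable_curve\<close>,
  \<open>line_integral\<close> and \<open>upper_gradient\<close> only know curves with that
  parameter interval.\<close>

definition subcurve :: "real \<Rightarrow> real \<Rightarrow> (real \<Rightarrow> 'a) \<Rightarrow> real \<Rightarrow> 'a" where
  "subcurve a b \<gamma> = (\<lambda>t. \<gamma> (a + (b - a) * t))"

lemma subcurve_image_subset:
  fixes a b :: real
  assumes "0 \<le> a" "a < b" "b \<le> 1"
  shows "(\<lambda>t. a + (b - a) * t) ` {0..1} \<subseteq> {0..1}"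
proof clarify
  fix t :: real assume "t \<in> {0..1}"
  then have "(b - a) * t \<le> b - a" "0 \<le> (b - a) * t"
    using assms by (simp_all add: mult_left_le)
  then have "a + (b - a) * t \<le> 1" "0 \<le> a + (b - a) * t" using assms by linarith+
  then show "a + (b - a) * t \<in> {0..1}" by simp
qed

lemma path_subcurve:
  assumes "path \<gamma>" "0 \<le> a" "a < b" "b \<le> 1"
  shows "path (subcurve a b \<gamma>)"
  unfolding path_def subcurve_def
  by (rule continuous_on_compose2[OF assms(1)[unfolded path_def]])
    (use subcurve_image_subset[OF assms(2-4)] in \<open>auto intro!: continuous_intros\<close>)

lemma path_image_subcurve_subset:
  fixes a b :: real
  assumes "0 \<le> a" "a < b" "b \<le> 1"
  shows "path_image (subcurve a b \<gamma>) \<subseteq> path_image \<gamma>"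
  using subcurve_image_subset[OF assms] unfolding path_image_def subcurve_def by blast

text \<open>The affine change of parameter and its inverse are both monotone, so
  \<open>curve_length_comp_le\<close> gives the two inequalities.\<close>

lemma curve_length_subcurve:
  assumes "a < b"
  shows "curve_length (subcurve a b \<gamma>) x y = curve_length \<gamma> (a + (b - a) * x) (a + (b - a) * y)"
proof (rule antisym)
  have m: "mono (\<lambda>x. a + (b - a) * x)"
    using assms by (auto simp: mono_def mult_left_mono)
  have m': "mono (\<lambda>x. (x - a) / (b - a))"
    using assms by (auto simp: mono_def divide_right_mono)
  have eq: "subcurve a b \<gamma> = \<gamma> \<circ> (\<lambda>x. a + (b - a) * x)"
    by (auto simp: subcurve_def)
  show "curve_length (subcurve a b \<gamma>) x y \<le> curve_length \<gamma> (a + (b - a) * x) (a + (b - a) * y)"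
    unfolding eq using curve_length_comp_le[OF m] .
  have "\<gamma> = subcurve a b \<gamma> \<circ> (\<lambda>x. (x - a) / (b - a))"
    using assms by (auto simp: subcurve_def fun_eq_iff)
  then show "curve_length \<gamma> (a + (b - a) * x) (a + (b - a) * y) \<le> curve_length (subcurve a b \<gamma>) x y"
    using curve_length_comp_le[OF m', of "subcurve a b \<gamma>" "a + (b - a) * x" "a + (b - a) * y"] assms
    by simp
qed

section \<open>The arc length parametrization\<close>

definition initial_length :: "(real \<Rightarrow> 'a::metric_space) \<Rightarrow> real \<Rightarrow> real" where
  "initial_length \<gamma> t = enn2real (curve_length \<gamma> 0 t)"

context
  fixes \<gamma> :: "real \<Rightarrow> 'a::metric_space"
  assumes rect: "rectifiable_curve \<gamma>"
begin

private abbreviation (input) "l \<equiv> initial_length \<gamma>"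

text \<open>Rectifiability makes the length finite up to parameter 1, so \<open>enn2real\<close>
  loses nothing there. For negative \<open>t\<close> there are no partitions and both sides are
  0.\<close>

lemma initial_length_eq: "t \<le> 1 \<Longrightarrow> curve_length \<gamma> 0 t = ennreal (l t)"
  unfolding initial_length_def using rect curve_length_mono[of 0 0 t 1 \<gamma>]
  by (auto simp: rectifiable_curve_def intro!: ennreal_enn2real[symmetric])

lemma initial_length_nonneg: "0 \<le> l t"
  by (simp add: initial_length_def)

lemma initial_length_mono: "\<lbrakk>s \<le> t; t \<le> 1\<rbrakk> \<Longrightarrow> l s \<le> l t"
  using curve_length_mono[of 0 0 s t \<gamma>] initial_length_eq[of s] initial_length_eq[of t]
    initial_length_nonneg[of t]
  by simp

lemma length_between_eq:
  assumes "0 \<le> s" "s \<le> t" "t \<le> 1"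
  shows "curve_length \<gamma> s t = ennreal (l t - l s)"
proof -
  have "ennreal (l s) + curve_length \<gamma> s t = ennreal (l s) + ennreal (l t - l s)"
    using curve_length_add[OF assms(1,2), of \<gamma>] assms initial_length_eq[of s] initial_length_eq[of t]
      initial_length_mono[OF assms(2,3)] initial_length_nonneg[of s]
    by (simp add: ennreal_plus[symmetric] del: ennreal_plus)
  then show ?thesis by (simp add: ennreal_add_left_cancel)
qed

lemma dist_le_initial_length_diff:
  assumes "0 \<le> s" "s \<le> t" "t \<le> 1"
  shows "dist (\<gamma> s) (\<gamma> t) \<le> l t - l s"
  using dist_le_curve_length[OF assms(2), of \<gamma>] length_between_eq[OF assms]
    initial_length_mono[OF assms(2,3)]
  by simp

lemma dist_le_initial_length_diff':
  assumes "0 \<le> s" "s \<le> 1" "0 \<le> t" "t \<le> 1"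
  shows "dist (\<gamma> s) (\<gamma> t) \<le> \<bar>l s - l t\<bar>"
proof (cases "s \<le> t")
  case True
  then show ?thesis using dist_le_initial_length_diff[of s t] assms by linarith
next
  case False
  then have "dist (\<gamma> t) (\<gamma> s) \<le> l s - l t"
    using dist_le_initial_length_diff[of t s] assms by linarith
  then show ?thesis by (simp add: dist_commute)
qed

text \<open>Both \<open>curve_length \<gamma> 0 t\<close> and \<open>curve_length \<gamma> t 1\<close> are lower semicontinuous in \<open>t\<close>
  and their sum is constant, so both are continuous.\<close>

lemma initial_length_continuous: "continuous_on {0..1} l"
proof -
  have pc: "continuous_on {0..1} \<gamma>"
    using rect by (auto simp: rectifiable_curve_def path_def)
  have lsc: "l t \<le> c" if "s \<longlonglongrightarrow> t" "\<And>k. s k \<in> {0..1}" "\<And>k. l (s k) \<le> c" "t \<le> 1" for s t c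
  proof -
    \<comment> \<open>\<open>ennreal\<close> sends negative reals to 0; this sign allows the return
      from \<open>ennreal c\<close> to \<open>c\<close>.\<close>
    have "0 \<le> c" using order_trans[OF initial_length_nonneg that(3)] by blast
    have "curve_length \<gamma> 0 t \<le> ennreal c"
      by (rule curve_length_lsc[OF pc tendsto_const that(1)])
        (use that \<open>0 \<le> c\<close> in \<open>auto simp: initial_length_eq ennreal_leI\<close>)
    then show ?thesis using that \<open>0 \<le> c\<close> by (simp add: initial_length_eq)
  qed
  have usc: "c \<le> l t" if "s \<longlonglongrightarrow> t" "\<And>k. s k \<in> {0..1}" "\<And>k. c \<le> l (s k)" "0 \<le> t" "t \<le> 1" for s t c
  proof -
    have "c \<le> l 1" using order_trans[OF that(3) initial_length_mono] that(2) by force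
    have "curve_length \<gamma> t 1 \<le> ennreal (l 1 - c)"
      by (rule curve_length_lsc[OF pc that(1) tendsto_const])
        (use that in \<open>auto simp: length_between_eq ennreal_leI\<close>)
    then show ?thesis using that \<open>c \<le> l 1\<close> by (simp add: length_between_eq)
  qed
  show ?thesis
    unfolding continuous_on_sequentially
  proof (intro allI ballI impI)
    fix s t assume t: "t \<in> {0..1}" and s: "(\<forall>n. s n \<in> {0..1}) \<and> s \<longlonglongrightarrow> (t::real)"
    show "(l \<circ> s) \<longlonglongrightarrow> l t"
    proof (rule ccontr)
      assume "\<not> ?thesis"
      then obtain e where e: "e > 0" "\<exists>\<^sub>F n in sequentially. \<not> dist (l (s n)) (l t) < e"
        unfolding tendsto_iff by (auto simp: not_eventually)
      \<comment> \<open>A deviation of at least \<open>e\<close> that occurs infinitely often occurs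
        infinitely often on one side; along a subsequence this contradicts \<open>lsc\<close> or
        \<open>usc\<close>.\<close>
      then have "(\<exists>\<^sub>F n in sequentially. l (s n) \<le> l t - e) \<or> (\<exists>\<^sub>F n in sequentially. l t + e \<le> l (s n))"
        unfolding frequently_disj_iff[symmetric]
        by (auto simp: dist_real_def elim!: frequently_elim1)
      then show False
      proof
        assume "\<exists>\<^sub>F n in sequentially. l (s n) \<le> l t - e"
        then have "infinite {n. l (s n) \<le> l t - e}"
          by (simp add: frequently_cofinite[symmetric] cofinite_eq_sequentially)
        from infinite_enumerate[OF this]
        obtain r where r: "strict_mono r" "\<And>n::nat. l (s (r n)) \<le> l t - e"
          by auto
        have "l t \<le> l t - e"
          by (rule lsc[of "s \<circ> r"]) (use r(2) s t LIMSEQ_subseq_LIMSEQ[OF _ r(1), of s t] in auto)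
        with e show False by simp
      next
        assume "\<exists>\<^sub>F n in sequentially. l t + e \<le> l (s n)"
        then have "infinite {n. l t + e \<le> l (s n)}"
          by (simp add: frequently_cofinite[symmetric] cofinite_eq_sequentially)
        from infinite_enumerate[OF this]
        obtain r where r: "strict_mono r" "\<And>n::nat. l t + e \<le> l (s (r n))"
          by auto
        have "l t + e \<le> l t"
          by (rule usc[of "s \<circ> r"]) (use r(2) s t LIMSEQ_subseq_LIMSEQ[OF _ r(1), of s t] in auto)
        with e show False by simp
      qed
    qed
  qed
qed

text \<open>The parameter picked by \<open>SOME\<close> has the same initial length as
  \<open>t\<close>, and distances on the curve are bounded by differences of initial lengths, so
  both parameters give the same point.\<close>

lemma arc_length_param_initial_length:
  assumes "0 \<le> t" "t \<le> 1"
  shows "arc_length_param \<gamma> (l t) = \<gamma> t"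
proof -
  define t' where "t' = (SOME t'. t' \<in> {0..1} \<and> curve_length \<gamma> 0 t' = ennreal (l t))"
  have "t' \<in> {0..1} \<and> curve_length \<gamma> 0 t' = ennreal (l t)"
    unfolding t'_def by (rule someI[of _ t]) (use assms in \<open>auto simp: initial_length_eq\<close>)
  then have t': "0 \<le> t'" "t' \<le> 1" "l t' = l t"
    using initial_length_nonneg by (auto simp: initial_length_eq)
  have "dist (\<gamma> t') (\<gamma> t) \<le> 0"
    using dist_le_initial_length_diff'[of t' t] t' assms by simp
  then have "\<gamma> t' = \<gamma> t" by simp
  then show ?thesis
    unfolding arc_length_param_def t'_def .
qed

lemma initial_length_onto:
  assumes "0 \<le> s" "s \<le> l 1"
  obtains t where "0 \<le> t" "t \<le> 1" "l t = s"
proof -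
  have "l 0 = 0"
    using length_between_eq[of 0 0] by (simp add: initial_length_def)
  then show ?thesis
    using IVT'[of l 0 s 1] initial_length_continuous assms that by auto
qed

text \<open>The parametrization is even 1-Lipschitz: every value in the interval is an initial
  length, and distances are bounded by differences of these. Continuity is what makes integrands
  along the curve Borel.\<close>

lemma arc_length_param_continuous: "continuous_on {0..l 1} (arc_length_param \<gamma>)"
proof -
  have "1-lipschitz_on {0..l 1} (arc_length_param \<gamma>)"
  proof (rule lipschitz_on_leI)
    fix s s' assume s: "s \<in> {0..l 1}" "s' \<in> {0..l 1}" "s \<le> s'"
    have "s \<le> l 1" "0 \<le> s'" "0 \<le> s" "s' \<le> l 1" using s by auto
    obtain t where t: "0 \<le> t" "t \<le> 1" "l t = s"
      using initial_length_onto[OF \<open>0 \<le> s\<close> \<open>s \<le> l 1\<close>] by metis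
    obtain t' where t': "0 \<le> t'" "t' \<le> 1" "l t' = s'"
      using initial_length_onto[OF \<open>0 \<le> s'\<close> \<open>s' \<le> l 1\<close>] by metis
    have "dist (\<gamma> t) (\<gamma> t') \<le> \<bar>s - s'\<bar>"
      using dist_le_initial_length_diff'[of t t'] t t' by simp
    then show "dist (arc_length_param \<gamma> s) (arc_length_param \<gamma> s') \<le> 1 * dist s s'"
      using arc_length_param_initial_length t t' by (auto simp: dist_real_def)
  qed simp
  then show ?thesis by (rule lipschitz_on_continuous_on)
qed

lemma borel_measurable_arc_length_param:
  assumes g: "g \<in> borel_measurable (restrict_space borel U)" and U: "path_image \<gamma> \<subseteq> U"
  shows "(\<lambda>s. g (arc_length_param \<gamma> s)) \<in> borel_measurable (restrict_space borel {0..l 1})"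
proof (rule measurable_compose[OF measurable_restrict_space2 g])
  show "arc_length_param \<gamma> \<in> borel_measurable (restrict_space borel {0..l 1})"
    by (rule borel_measurable_continuous_on_restrict[OF arc_length_param_continuous])
  show "arc_length_param \<gamma> \<in> space (restrict_space borel {0..l 1}) \<rightarrow> U"
  proof
    fix s assume "s \<in> space (restrict_space borel {0..l 1})"
    then obtain t where "0 \<le> t" "t \<le> 1" "l t = s"
      using initial_length_onto by (auto simp: space_restrict_space)
    then show "arc_length_param \<gamma> s \<in> U"
      using U arc_length_param_initial_length by (force simp: path_image_def)
  qed
qed

lemma rectifiable_subcurve:
  assumes "0 \<le> a" "a < b" "b \<le> 1"
  shows "rectifiable_curve (subcurve a b \<gamma>)"
proof -
  have "curve_length \<gamma> a b < \<infinity>"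
    using assms by (simp add: length_between_eq)
  then show ?thesis
    using rect assms by (auto simp: rectifiable_curve_def curve_length_subcurve intro!: path_subcurve)
qed

lemma initial_length_subcurve:
  assumes "0 \<le> a" "a < b" "b \<le> 1" "0 \<le> t" "t \<le> 1"
  shows "initial_length (subcurve a b \<gamma>) t = l (a + (b - a) * t) - l a"
proof -
  have "(b - a) * t \<le> b - a" "0 \<le> (b - a) * t"
    using assms by (simp_all add: mult_left_le)
  then have t: "a + (b - a) * t \<le> 1" "a \<le> a + (b - a) * t" using assms by linarith+
  then show ?thesis
    using length_between_eq[OF assms(1) t(2) t(1)] assms initial_length_mono[OF t(2,1)]
    by (simp add: initial_length_def[of "subcurve a b \<gamma>"] curve_length_subcurve)
qed

end

section \<open>Line integrals along subcurves\<close>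

lemma line_integral_subcurve:
  assumes rect: "rectifiable_curve \<gamma>" and ab: "0 \<le> a" "a < b" "b \<le> 1"
    and g: "g \<in> borel_measurable (restrict_space borel U)" and U: "path_image \<gamma> \<subseteq> U"
  shows "line_integral g (subcurve a b \<gamma>) =
    (\<integral>\<^sup>+ s \<in> {initial_length \<gamma> a..initial_length \<gamma> b}. g (arc_length_param \<gamma> s) \<partial>lborel)"
proof -
  let ?l = "initial_length \<gamma>" and ?\<gamma> = "subcurve a b \<gamma>"
  note l_sub = initial_length_subcurve[OF rect ab]
  have l1: "initial_length ?\<gamma> 1 = ?l b - ?l a"
    using l_sub[of 1] by simp
  \<comment> \<open>The arc length parametrization of the subcurve is that of the whole curve
    shifted by \<open>?l a\<close>; the integral formula is then translation invariance of
    \<open>lborel\<close>.\<close>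
  have param: "arc_length_param ?\<gamma> s = arc_length_param \<gamma> (?l a + s)"
    if s: "0 \<le> s" "s \<le> ?l b - ?l a" for s
  proof -
    obtain t where t: "0 \<le> t" "t \<le> 1" "initial_length ?\<gamma> t = s"
      using initial_length_onto[OF rectifiable_subcurve[OF rect ab] s(1)] s(2) l1 by auto
    have t': "a + (b - a) * t \<le> 1" "0 \<le> a + (b - a) * t"
      using subcurve_image_subset[OF ab] t by (auto simp: image_subset_iff)
    have "arc_length_param ?\<gamma> s = ?\<gamma> t"
      using arc_length_param_initial_length[OF rectifiable_subcurve[OF rect ab] t(1,2)] t(3) by simp
    also have "\<dots> = \<gamma> (a + (b - a) * t)"
      by (simp add: subcurve_def)
    also have "\<dots> = arc_length_param \<gamma> (?l a + s)"
      using arc_length_param_initial_length[OF rect t'(2,1)] l_sub[OF t(1,2)] t(3) by simp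
    finally show ?thesis .
  qed
  \<comment> \<open>The substitution asks for a Borel function on the whole line, but
    \<open>g\<close> is Borel only on \<open>U\<close>; hence the extension by zero.\<close>
  define h where "h s = g (arc_length_param \<gamma> s) * indicator {?l a..?l b} s" for s
  have "0 \<le> ?l a" "?l b \<le> ?l 1"
    using ab initial_length_nonneg[OF rect] initial_length_mono[OF rect] by auto
  then have "{?l a..?l b} \<subseteq> {0..?l 1}" by auto
  then have "(\<lambda>s. g (arc_length_param \<gamma> s)) \<in> borel_measurable (restrict_space borel {?l a..?l b})"
    using measurable_restrict_mono[OF borel_measurable_arc_length_param[OF rect g U]] by blast
  then have h: "h \<in> borel_measurable borel"
    unfolding h_def by (subst (asm) borel_measurable_restrict_space_iff_ennreal) auto
  have "line_integral g ?\<gamma> = (\<integral>\<^sup>+ s. h (?l a + 1 * s) \<partial>lborel)"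
    unfolding line_integral_def initial_length_def[symmetric] l1
    by (rule nn_integral_cong) (auto simp: h_def param split: split_indicator)
  also have "\<dots> = (\<integral>\<^sup>+ s. h s \<partial>lborel)"
    using nn_integral_real_affine[OF h, of 1 "?l a"] by simp
  finally show ?thesis by (simp add: h_def)
qed

text \<open>An arc length strictly between those of \<open>a\<close> and \<open>b\<close> belongs to
  a parameter strictly between \<open>a\<close> and \<open>b\<close>. The two remaining arc lengths
  form a null set, so the end points may lie outside \<open>W\<close>; this matters because the
  subcurves used later may end where the function vanishes.\<close>

lemma line_integral_subcurve_le:
  assumes rect: "rectifiable_curve \<gamma>" and ab: "0 \<le> a" "a < b" "b \<le> 1"
    and g: "g \<in> borel_measurable (restrict_space borel U)" and U: "path_image \<gamma> \<subseteq> U"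
    and W: "\<gamma> ` {a<..<b} \<subseteq> W"
  shows "line_integral g (subcurve a b \<gamma>) \<le> line_integral (\<lambda>x. g x * indicator W x) \<gamma>"
proof -
  let ?l = "initial_length \<gamma>"
  have bd: "0 \<le> ?l a" "?l b \<le> ?l 1"
    using ab initial_length_nonneg[OF rect] initial_length_mono[OF rect] by auto
  have in_W: "arc_length_param \<gamma> s \<in> W" if s: "?l a < s" "s < ?l b" for s
  proof -
    obtain t where t: "0 \<le> t" "t \<le> 1" "?l t = s"
      using initial_length_onto[OF rect, of s] s bd by auto
    have "a < t" using initial_length_mono[OF rect, of t a] s t ab by force
    moreover have "t < b" using initial_length_mono[OF rect, of b t] s t ab by force
    ultimately show ?thesis
      using W arc_length_param_initial_length[OF rect t(1,2)] t(3) by auto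
  qed
  have "AE s in lborel. s \<noteq> ?l a \<and> s \<noteq> ?l b"
    using AE_lborel_singleton[of "?l a"] AE_lborel_singleton[of "?l b"] by eventually_elim auto
  then have "AE s in lborel. g (arc_length_param \<gamma> s) * indicator {?l a..?l b} s \<le>
    g (arc_length_param \<gamma> s) * indicator W (arc_length_param \<gamma> s) * indicator {0..?l 1} s"
    by eventually_elim (use in_W bd in \<open>auto split: split_indicator\<close>)
  then show ?thesis
    unfolding line_integral_subcurve[OF rect ab g U]
    unfolding line_integral_def initial_length_def[symmetric]
    by (rule nn_integral_mono_AE)
qed

section \<open>Upper gradients of positive parts\<close>

lemma pos_part_diff_witness:
  fixes h :: "real \<Rightarrow> real"
  assumes h: "continuous_on {0..1} h" and ne: "max (h 0) 0 \<noteq> max (h 1) 0"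
  obtains a b where "0 \<le> a" "a < b" "b \<le> 1" "\<And>t. a < t \<Longrightarrow> t < b \<Longrightarrow> 0 < h t"
    "\<bar>max (h 0) 0 - max (h 1) 0\<bar> \<le> \<bar>h a - h b\<bar>"
proof -
  define Z where "Z = {t \<in> {0..1}. h t \<le> 0}"
  have "closed Z"
    unfolding Z_def using continuous_on_closed_Collect_le[OF h continuous_on_const] by simp
  then have Z: "compact Z"
    using compact_Int_closed[OF compact_Icc, of Z 0 1] by (simp add: Int_absorb1 Z_def subset_iff)
  show ?thesis
  proof (cases "Z = {}")
    case True
    then have "\<And>t. 0 \<le> t \<Longrightarrow> t \<le> 1 \<Longrightarrow> 0 < h t" unfolding Z_def by force
    then have pos: "0 < h t" if "0 \<le> t" "t \<le> 1" for t using that by blast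
    show ?thesis
      by (rule that[of 0 1]) (use pos[of 0] pos[of 1] pos in auto)
  next
    case False
    \<comment> \<open>Start at the end with the larger positive part and go to the nearest point of
      \<open>Z\<close>. There \<open>h\<close> is at most 0, so \<open>h\<close> changes by at least
      the larger positive part, hence by at least the difference.\<close>
    consider "max (h 1) 0 < max (h 0) 0" | "max (h 0) 0 < max (h 1) 0" using ne by linarith
    then show ?thesis
    proof cases
      case 1
      obtain b where b: "b \<in> Z" "\<And>t. t \<in> Z \<Longrightarrow> b \<le> t"
        using compact_attains_inf[OF Z False] by auto
      have "0 < b" using b(1) 1 by (cases "b = 0") (auto simp: Z_def)
      have "b \<le> 1" "h b \<le> 0" using b(1) by (auto simp: Z_def)
      show ?thesis
      proof (rule that[of 0 b])
        show "0 < h t" if "0 < t" "t < b" for t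
          using b(2)[of t] that \<open>b \<le> 1\<close> by (force simp: Z_def)
        show "\<bar>max (h 0) 0 - max (h 1) 0\<bar> \<le> \<bar>h 0 - h b\<bar>"
          using 1 \<open>h b \<le> 0\<close> by linarith
      qed (use \<open>0 < b\<close> \<open>b \<le> 1\<close> in auto)
    next
      case 2
      obtain a where a: "a \<in> Z" "\<And>t. t \<in> Z \<Longrightarrow> t \<le> a"
        using compact_attains_sup[OF Z False] by auto
      have "a < 1" using a(1) 2 by (cases "a = 1") (auto simp: Z_def)
      have "0 \<le> a" "h a \<le> 0" using a(1) by (auto simp: Z_def)
      show ?thesis
      proof (rule that[of a 1])
        show "0 < h t" if "a < t" "t < 1" for t
          using a(2)[of t] that \<open>0 \<le> a\<close> by (force simp: Z_def)
        show "\<bar>max (h 0) 0 - max (h 1) 0\<bar> \<le> \<bar>h a - h 1\<bar>"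
          using 2 \<open>h a \<le> 0\<close> by linarith
      qed (use \<open>a < 1\<close> \<open>0 \<le> a\<close> in auto)
    qed
  qed
qed

text \<open>Continuity of \<open>v\<close> enters twice: it makes the set where \<open>v\<close> is
  positive Borel in \<open>U\<close>, and it lets \<open>pos_part_diff_witness\<close> be applied
  along each curve.\<close>

lemma upper_gradient_pos_part:
  assumes v: "continuous_on U v" and g: "upper_gradient U g (\<lambda>x. ereal (v x))"
  shows "upper_gradient U (\<lambda>x. g x * indicator {x. 0 < v x} x) (\<lambda>x. ereal (max (v x) 0))"
  unfolding upper_gradient_def
proof (intro conjI allI impI)
  have gm: "g \<in> borel_measurable (restrict_space borel U)"
    using g by (simp add: upper_gradient_def)
  note [measurable] = gm borel_measurable_continuous_on_restrict[OF v]
  show "(\<lambda>x. g x * indicator {x. 0 < v x} x) \<in> borel_measurable (restrict_space borel U)"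
    by measurable
  fix \<gamma> :: "real \<Rightarrow> 'a"
  assume \<gamma>: "rectifiable_curve \<gamma> \<and> path_image \<gamma> \<subseteq> U \<and> \<not> \<gamma> constant_on {0..1}"
  let ?I = "line_integral (\<lambda>x. g x * indicator {x. 0 < v x} x) \<gamma>"
  have e2: "e2ennreal \<bar>ereal x - ereal y\<bar> = ennreal \<bar>x - y\<bar>" for x y
    by simp
  show "e2ennreal \<bar>ereal (max (v (pathstart \<gamma>)) 0) - ereal (max (v (pathfinish \<gamma>)) 0)\<bar> \<le> ?I"
  proof (cases "max (v (\<gamma> 0)) 0 = max (v (\<gamma> 1)) 0")
    case True
    then show ?thesis unfolding e2 by (simp add: pathstart_def pathfinish_def)
  next
    case False
    have "continuous_on {0..1} (\<lambda>t. v (\<gamma> t))"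
      using \<gamma> v by (intro continuous_on_compose2[OF v])
        (auto simp: rectifiable_curve_def path_def path_image_def)
    from pos_part_diff_witness[OF this] False
    obtain a b where ab: "0 \<le> a" "a < b" "b \<le> 1" "\<And>t. a < t \<Longrightarrow> t < b \<Longrightarrow> 0 < v (\<gamma> t)"
      "\<bar>max (v (\<gamma> 0)) 0 - max (v (\<gamma> 1)) 0\<bar> \<le> \<bar>v (\<gamma> a) - v (\<gamma> b)\<bar>" by auto
    let ?\<gamma> = "subcurve a b \<gamma>"
    \<comment> \<open>\<open>upper_gradient\<close> speaks of nonconstant curves only; this subcurve
      qualifies because \<open>v\<close> separates its end points.\<close>
    have "v (\<gamma> a) \<noteq> v (\<gamma> b)" using ab(5) False by auto
    then have "?\<gamma> 0 \<noteq> ?\<gamma> 1" unfolding subcurve_def by force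
    moreover have "?\<gamma> 0 = ?\<gamma> 1" if "?\<gamma> constant_on {0..1}"
      using that unfolding constant_on_def by fastforce
    ultimately have "\<not> ?\<gamma> constant_on {0..1}" by blast
    moreover have "path_image ?\<gamma> \<subseteq> U"
      using path_image_subcurve_subset[of a b \<gamma>] \<gamma> ab by force
    ultimately have "e2ennreal \<bar>ereal (v (pathstart ?\<gamma>)) - ereal (v (pathfinish ?\<gamma>))\<bar> \<le> line_integral g ?\<gamma>"
      using g rectifiable_subcurve[of \<gamma> a b] \<gamma> ab unfolding upper_gradient_def by blast
    then have "ennreal \<bar>v (\<gamma> a) - v (\<gamma> b)\<bar> \<le> line_integral g ?\<gamma>"
      unfolding e2 by (simp add: pathstart_def pathfinish_def subcurve_def)
    also have "\<dots> \<le> ?I"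
      by (rule line_integral_subcurve_le[OF _ _ _ _ gm]) (use \<gamma> ab in auto)
    finally show ?thesis
      unfolding e2 pathstart_def pathfinish_def
      using ennreal_leI[OF ab(5)] by (rule order_trans[rotated])
  qed
qed

section \<open>Doubling measures\<close>

lemma space_caratheodory_measure [simp]: "space (caratheodory_measure \<mu>) = UNIV"
  unfolding caratheodory_measure_def
  by (rule space_measure_of) auto

lemma borel_measurable_caratheodory_measure:
  assumes "borel_regular_outer_measure \<mu>" and "f \<in> borel_measurable borel"
  shows "f \<in> borel_measurable (caratheodory_measure \<mu>)"
proof -
  have "lambda_system UNIV (Pow UNIV) \<mu> \<subseteq> Pow UNIV" by simp
  then have "sets (caratheodory_measure \<mu>) = sigma_sets UNIV (lambda_system UNIV (Pow UNIV) \<mu>)"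
    unfolding caratheodory_measure_def by (rule sets_measure_of)
  then have "sets borel \<subseteq> sets (caratheodory_measure \<mu>)"
    using assms(1) by (auto simp: borel_regular_outer_measure_def intro: sigma_sets.Basic)
  then show ?thesis
    using assms(2) measurable_sets_borel[OF assms(2)] by (intro measurableI) auto
qed

lemma borel_in_sets_caratheodory_measure:
  assumes "borel_regular_outer_measure \<mu>" and "A \<in> sets borel"
  shows "A \<in> sets (caratheodory_measure \<mu>)"
proof -
  have "(indicator A :: 'a \<Rightarrow> real) \<in> borel_measurable (caratheodory_measure \<mu>)"
    using assms by (intro borel_measurable_caratheodory_measure) auto
  then show ?thesis by (simp add: borel_measurable_indicator_iff)
qed

lemma emeasure_caratheodory_measure:
  assumes "borel_regular_outer_measure \<mu>" and "A \<in> sets borel"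
  shows "emeasure (caratheodory_measure \<mu>) A = \<mu> A"
proof -
  have "measure_space UNIV (lambda_system UNIV (Pow UNIV) \<mu>) \<mu>"
    using assms(1) unfolding borel_regular_outer_measure_def
    by (intro sigma_algebra.caratheodory_lemma[OF sigma_algebra_Pow]) blast
  then show ?thesis
    unfolding caratheodory_measure_def measure_space_def
    using assms by (intro emeasure_measure_of_sigma) (auto simp: borel_regular_outer_measure_def)
qed

text \<open>Disjoint balls of a fixed radius inside a fixed ball have comparable measures, so there are
  only boundedly many of them; hence bounded sets are totally bounded.\<close>

lemma compact_cball_doubling:
  fixes \<mu> :: "'a::complete_space set \<Rightarrow> ennreal" and x :: 'a
  assumes reg: "borel_regular_outer_measure \<mu>" and "doubling \<mu>"
  shows "compact (cball x r)"
proof -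
  let ?M = "caratheodory_measure \<mu>"
  have em: "emeasure ?M (ball y s) = \<mu> (ball y s)" for y s
    by (rule emeasure_caratheodory_measure[OF reg]) simp
  have sets: "ball y s \<in> sets ?M" for y s
    by (rule borel_in_sets_caratheodory_measure[OF reg]) simp
  have ball_subset: "ball y s \<subseteq> ball z t" if "dist z y + s \<le> t" for y z :: 'a and s t
  proof
    fix w assume "w \<in> ball y s"
    then show "w \<in> ball z t" using dist_triangle[of z w y] that by simp
  qed
  obtain C where C: "1 \<le> C" "\<And>y s. 0 < s \<Longrightarrow> 0 < \<mu> (ball y (2 * s))"
    "\<And>y s. 0 < s \<Longrightarrow> \<mu> (ball y (2 * s)) \<le> ennreal C * \<mu> (ball y s)"
    "\<And>y s. 0 < s \<Longrightarrow> ennreal C * \<mu> (ball y s) < \<infinity>"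
    using assms(2) unfolding doubling_def by blast
  have "\<exists>k. finite k \<and> cball x r \<subseteq> (\<Union>y\<in>k. ball y e)" if "0 < e" for e
  proof -
    \<comment> \<open>Large enough for \<open>ball x R\<close> to contain the balls of radius e/2
      about all points of \<open>cball x r\<close>, and positive even if \<open>r\<close> is
      negative.\<close>
    define R where "R = \<bar>r\<bar> + e"
    have R: "0 < R" using \<open>0 < e\<close> by (simp add: R_def)
    define s where "s = e / 2"
    have s: "0 < s" using \<open>0 < e\<close> by (simp add: s_def)
    have iter: "\<mu> (ball y (2 ^ n * s)) \<le> ennreal (C ^ n) * \<mu> (ball y s)" for y n
    proof (induction n)
      case (Suc n)
      have "\<mu> (ball y (2 ^ Suc n * s)) \<le> ennreal C * \<mu> (ball y (2 ^ n * s))"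
        using C(3)[of "2 ^ n * s" y] s by (simp add: mult.assoc)
      also have "\<dots> \<le> ennreal C * (ennreal (C ^ n) * \<mu> (ball y s))"
        by (intro mult_left_mono Suc) auto
      also have "\<dots> = ennreal (C ^ Suc n) * \<mu> (ball y s)"
        using C(1) by (simp add: ennreal_mult mult.assoc)
      finally show ?case .
    qed simp
    \<comment> \<open>With this \<open>n\<close>, the ball of radius \<open>2 ^ n * s\<close> about
      any point of \<open>cball x r\<close> contains \<open>ball x R\<close>. So \<open>n\<close>
      doublings bound the measure of \<open>ball x R\<close> by that of each small ball, uniformly
      in the centre.\<close>
    obtain n where n: "2 * R / s < 2 ^ n"
      using real_arch_pow[of 2] by auto
    have big: "\<mu> (ball x R) \<le> ennreal (C ^ n) * \<mu> (ball y s)" if "y \<in> cball x r" for y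
    proof -
      have "dist x y \<le> \<bar>r\<bar>" using that by auto
      moreover have "2 * R < 2 ^ n * s" using n s by (simp add: field_simps)
      ultimately have "ball x R \<subseteq> ball y (2 ^ n * s)"
        by (intro ball_subset) (use \<open>0 < e\<close> in \<open>simp add: R_def dist_commute\<close>)
      then have "\<mu> (ball x R) \<le> \<mu> (ball y (2 ^ n * s))"
        unfolding em[symmetric] by (rule emeasure_mono) (rule sets)
      also have "\<dots> \<le> ennreal (C ^ n) * \<mu> (ball y s)" by (rule iter)
      finally show ?thesis .
    qed
    define separated where
      "separated F \<longleftrightarrow> finite F \<and> F \<subseteq> cball x r \<and> (\<forall>y\<in>F. \<forall>z\<in>F. y \<noteq> z \<longrightarrow> e \<le> dist y z)" for F
    have pos: "0 < \<mu> (ball x R)" using C(2)[of "R / 2" x] R by simp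
    have "\<mu> (ball x R) \<le> ennreal C * \<mu> (ball x (R/2))" using C(3)[of "R/2" x] R by simp
    then have fin: "\<mu> (ball x R) < \<infinity>" using C(4)[of "R/2" x] R by (auto intro: order.strict_trans1)
    have bound: "card F < Suc (nat \<lceil>C ^ n\<rceil>)" if F: "separated F" for F
    proof -
      have "of_nat (card F) * \<mu> (ball x R) = (\<Sum>y\<in>F. \<mu> (ball x R))" by simp
      also have "\<dots> \<le> (\<Sum>y\<in>F. ennreal (C ^ n) * \<mu> (ball y s))"
        using F by (intro sum_mono big) (auto simp: separated_def)
      also have "\<dots> = ennreal (C ^ n) * (\<Sum>y\<in>F. emeasure ?M (ball y s))"
        by (simp add: sum_distrib_left em)
      also have "(\<Sum>y\<in>F. emeasure ?M (ball y s)) = emeasure ?M (\<Union>y\<in>F. ball y s)"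
      proof (rule sum_emeasure)
        show "disjoint_family_on (\<lambda>y. ball y s) F"
          unfolding disjoint_family_on_def
        proof (intro ballI impI)
          fix y z assume yz: "y \<in> F" "z \<in> F" "y \<noteq> z"
          then have "e \<le> dist y z" using F by (auto simp: separated_def)
          then show "ball y s \<inter> ball z s = {}" by (intro disjoint_ballI) (simp add: s_def)
        qed
      qed (use F sets in \<open>auto simp: separated_def\<close>)
      also have "\<dots> \<le> emeasure ?M (ball x R)"
      proof (rule emeasure_mono)
        have "ball y s \<subseteq> ball x R" if "y \<in> F" for y
        proof -
          have "dist x y \<le> r" using that F by (auto simp: separated_def)
          then show ?thesis
            using s by (intro ball_subset) (auto simp: R_def s_def)
        qed
        then show "(\<Union>y\<in>F. ball y s) \<subseteq> ball x R" by blast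
      qed (rule sets)
      finally have "of_nat (card F) * \<mu> (ball x R) \<le> ennreal (C ^ n) * \<mu> (ball x R)"
        by (simp add: em mult_left_mono)
      then have "ennreal (real (card F)) \<le> ennreal (C ^ n)"
        using pos fin ennreal_mult_le_mult_iff[of "\<mu> (ball x R)"]
        by (simp add: ennreal_of_nat_eq_real_of_nat mult.commute)
      then have "real (card F) \<le> C ^ n" using C(1) by simp
      then show ?thesis by linarith
    qed
    have "separated {}" by (simp add: separated_def)
    \<comment> \<open>A separated set of greatest cardinality is an \<open>e\<close>-net: a point at
      distance at least \<open>e\<close> from all of it could be added.\<close>
    then obtain F where F: "separated F" "\<And>F'. separated F' \<Longrightarrow> card F' \<le> card F"
      using ex_has_greatest_nat[of separated "{}" card] bound by blast
    have "\<exists>y\<in>F. z \<in> ball y e" if z: "z \<in> cball x r" for z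
    proof (rule ccontr)
      assume "\<not> ?thesis"
      then have far: "\<forall>y\<in>F. e \<le> dist y z" by auto
      then have "z \<notin> F" using \<open>0 < e\<close> by auto
      moreover have "separated (insert z F)"
        using F(1) far z by (auto simp: separated_def dist_commute)
      ultimately show False
        using F(2)[of "insert z F"] F(1) by (auto simp: separated_def)
    qed
    then show ?thesis using F(1) by (intro exI[of _ F]) (auto simp: separated_def)
  qed
  then show ?thesis
    unfolding compact_eq_totally_bounded by (simp add: complete_eq_closed)
qed

lemma compactly_inside_neighbourhood:
  fixes \<mu> :: "'a::complete_space set \<Rightarrow> ennreal" and x :: 'a
  assumes "borel_regular_outer_measure \<mu>" "doubling \<mu>" "open U" "x \<in> U"
  obtains V where "x \<in> V" "compactly_inside V U"
proof -
  obtain e where e: "0 < e" "cball x e \<subseteq> U"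
    using assms(3,4) open_contains_cball by blast
  have "closure (ball x e) \<subseteq> cball x e" by (simp add: closure_minimal ball_subset_cball)
  moreover from this have "compact (closure (ball x e))"
    using compact_Int_closed[OF compact_cball_doubling[OF assms(1,2)] closed_closure, of x e "ball x e"]
    by (simp add: Int_absorb1)
  ultimately show ?thesis
    using e by (intro that[of "ball x e"]) (auto simp: compactly_inside_def)
qed

lemma compactly_inside_mono: "compactly_inside W V \<Longrightarrow> V \<subseteq> U \<Longrightarrow> compactly_inside W U"
  unfolding compactly_inside_def by blast

lemma compactly_inside_subset: "compactly_inside V U \<Longrightarrow> V \<subseteq> U"
  unfolding compactly_inside_def using closure_subset by blast

text \<open>\<open>lip_loc\<close> gives information only on sets compactly inside \<open>U\<close>.
  Compactness of closed balls ensures that every point of \<open>U\<close> has such a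
  neighbourhood.\<close>

lemma continuous_on_lip_loc:
  fixes \<mu> :: "'a::complete_space set \<Rightarrow> ennreal" and v :: "'a \<Rightarrow> real"
  assumes "borel_regular_outer_measure \<mu>" "doubling \<mu>" "open U" "lip_loc U v"
  shows "continuous_on U v"
proof (rule continuous_at_imp_continuous_on, rule ballI)
  fix x assume "x \<in> U"
  then obtain V where V: "x \<in> V" "compactly_inside V U"
    using compactly_inside_neighbourhood[OF assms(1-3)] by blast
  then obtain C where "C-lipschitz_on V v" using assms(4) by (auto simp: lip_loc_def)
  then have "continuous_on V v" by (rule lipschitz_on_continuous_on)
  then show "isCont v x"
    using V by (simp add: compactly_inside_def continuous_on_eq_continuous_at)
qed

section \<open>Total variation\<close>

lemma total_variation_le:
  assumes "\<And>i. lip_loc U (v i)" "L1_loc_tendsto \<mu> U v u"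
    and "\<And>i. upper_gradient U (g i) (\<lambda>x. ereal (v i x))"
  shows "total_variation \<mu> U u \<le> liminf (\<lambda>i. \<integral>\<^sup>+ x \<in> U. g i x \<partial>caratheodory_measure \<mu>)"
  unfolding total_variation_def by (rule Inf_lower) (use assms in blast)

lemma total_variation_greatest:
  assumes "\<And>v g. (\<And>i. lip_loc U (v i)) \<Longrightarrow> L1_loc_tendsto \<mu> U v u \<Longrightarrow>
    (\<And>i. upper_gradient U (g i) (\<lambda>x. ereal (v i x))) \<Longrightarrow>
    c \<le> liminf (\<lambda>i. \<integral>\<^sup>+ x \<in> U. g i x \<partial>caratheodory_measure \<mu>)"
  shows "c \<le> total_variation \<mu> U u"
  unfolding total_variation_def by (rule Inf_greatest) (use assms in blast)

lemma total_variation_lessE: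
  assumes "total_variation \<mu> U u < c"
  obtains v g where "\<And>i. lip_loc U (v i)" "L1_loc_tendsto \<mu> U v u"
    "\<And>i. upper_gradient U (g i) (\<lambda>x. ereal (v i x))"
    "liminf (\<lambda>i. \<integral>\<^sup>+ x \<in> U. g i x \<partial>caratheodory_measure \<mu>) < c"
  using assms unfolding total_variation_def Inf_less_iff by blast

section \<open>Total variation after composition with a 1-Lipschitz function of the values\<close>

lemma L1_loc_tendsto_lipschitz_comp:
  assumes v: "L1_loc_tendsto \<mu> U v u" and f: "\<And>a b. \<bar>f a - f b\<bar> \<le> \<bar>a - b\<bar>"
    and w: "\<And>x. x \<in> U \<Longrightarrow> w x = f (u x)"
  shows "L1_loc_tendsto \<mu> U (\<lambda>i x. f (v i x)) w"
  unfolding L1_loc_tendsto_def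
proof (intro allI impI)
  fix V assume V: "compactly_inside V U"
  then have "V \<subseteq> U" by (rule compactly_inside_subset)
  have lim: "(\<lambda>i. \<integral>\<^sup>+ x \<in> V. ennreal \<bar>v i x - u x\<bar> \<partial>caratheodory_measure \<mu>) \<longlonglongrightarrow> 0"
    using v V by (simp add: L1_loc_tendsto_def)
  show "(\<lambda>i. \<integral>\<^sup>+ x \<in> V. ennreal \<bar>f (v i x) - w x\<bar> \<partial>caratheodory_measure \<mu>) \<longlonglongrightarrow> 0"
    by (rule tendsto_sandwich[OF always_eventually always_eventually tendsto_const lim])
      (use f w \<open>V \<subseteq> U\<close> in \<open>auto intro!: nn_integral_mono ennreal_leI split: split_indicator\<close>)
qed

lemma lip_loc_lipschitz_comp:
  assumes v: "lip_loc U v" and f: "\<And>a b. \<bar>f a - f b\<bar> \<le> \<bar>a - b\<bar>"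
  shows "lip_loc U (\<lambda>x. f (v x))"
  unfolding lip_loc_def
proof (intro allI impI)
  fix V assume "compactly_inside V U"
  then obtain C where C: "C-lipschitz_on V v" using v by (auto simp: lip_loc_def)
  have "1-lipschitz_on (v ` V) f"
    by (rule lipschitz_onI) (use f in \<open>auto simp: dist_real_def\<close>)
  from lipschitz_on_compose2[OF C this]
  show "\<exists>C. C-lipschitz_on V (\<lambda>x. f (v x))" by blast
qed

lemma upper_gradient_lipschitz_comp:
  assumes g: "upper_gradient U g (\<lambda>x. ereal (v x))" and f: "\<And>a b. \<bar>f a - f b\<bar> \<le> \<bar>a - b\<bar>"
  shows "upper_gradient U g (\<lambda>x. ereal (f (v x)))"
proof -
  have "ennreal \<bar>f a - f b\<bar> \<le> I" if "ennreal \<bar>a - b\<bar> \<le> I" for a b I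
    using ennreal_leI[OF f] that by (rule order_trans)
  then show ?thesis using g unfolding upper_gradient_def by simp
qed

text \<open>Composing an approximating sequence with \<open>f\<close> preserves local Lipschitz
  continuity and convergence, and every upper gradient remains one. Used for changes of sign and for
  the truncation to [0,1].\<close>

lemma total_variation_lipschitz_comp:
  assumes f: "\<And>a b. \<bar>f a - f b\<bar> \<le> \<bar>a - b\<bar>" and w: "\<And>x. x \<in> U \<Longrightarrow> w x = f (u x)"
  shows "total_variation \<mu> U w \<le> total_variation \<mu> U u"
proof (rule total_variation_greatest)
  fix v g assume vg: "\<And>i. lip_loc U (v i)" "L1_loc_tendsto \<mu> U v u"
    "\<And>i. upper_gradient U (g i) (\<lambda>x. ereal (v i x))"
  show "total_variation \<mu> U w \<le> liminf (\<lambda>i. \<integral>\<^sup>+ x \<in> U. g i x \<partial>caratheodory_measure \<mu>)"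
    by (rule total_variation_le[where v = "\<lambda>i x. f (v i x)"])
      (use vg f w in \<open>auto intro: lip_loc_lipschitz_comp L1_loc_tendsto_lipschitz_comp
        upper_gradient_lipschitz_comp\<close>)
qed

lemma total_variation_uminus:
  "total_variation \<mu> U (\<lambda>x. - u x) = total_variation \<mu> U u"
  by (intro antisym total_variation_lipschitz_comp[where f = uminus]) auto

lemma total_variation_mono:
  assumes "V \<subseteq> U"
  shows "total_variation \<mu> V u \<le> total_variation \<mu> U u"
proof (rule total_variation_greatest)
  fix v g assume vg: "\<And>i. lip_loc U (v i)" "L1_loc_tendsto \<mu> U v u"
    "\<And>i. upper_gradient U (g i) (\<lambda>x. ereal (v i x))"
  have "total_variation \<mu> V u \<le> liminf (\<lambda>i. \<integral>\<^sup>+ x \<in> V. g i x \<partial>caratheodory_measure \<mu>)"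
  proof (rule total_variation_le)
    show "lip_loc V (v i)" for i
      using vg(1)[of i] assms compactly_inside_mono unfolding lip_loc_def by blast
    show "L1_loc_tendsto \<mu> V v u"
      using vg(2) assms compactly_inside_mono unfolding L1_loc_tendsto_def by blast
    show "upper_gradient V (g i) (\<lambda>x. ereal (v i x))" for i
      using vg(3)[of i] assms measurable_restrict_mono[OF _ assms, of "g i"]
      unfolding upper_gradient_def by (blast intro: order_trans)
  qed
  also have "\<dots> \<le> liminf (\<lambda>i. \<integral>\<^sup>+ x \<in> U. g i x \<partial>caratheodory_measure \<mu>)"
    by (intro Liminf_mono always_eventually allI nn_integral_mono)
      (use assms in \<open>auto split: split_indicator\<close>)
  finally show "total_variation \<mu> V u \<le> \<dots>" .
qed

lemma liminf_add_ennreal: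
  fixes a b :: "nat \<Rightarrow> ennreal"
  shows "liminf a + liminf b \<le> liminf (\<lambda>i. a i + b i)"
proof -
  have "liminf a + liminf b = (SUP n. (INF m\<in>{n..}. a m) + (INF m\<in>{n..}. b m))"
    unfolding liminf_SUP_INF
    by (rule ennreal_SUP_add[symmetric]) (auto intro!: monoI INF_superset_mono)
  also have "\<dots> \<le> liminf (\<lambda>i. a i + b i)"
    unfolding liminf_SUP_INF
    by (intro SUP_mono') (auto intro!: INF_greatest add_mono INF_lower)
  finally show ?thesis .
qed

lemma upper_gradient_borel:
  assumes "open U" "upper_gradient U g u"
  shows "(\<lambda>x. g x * indicator U x) \<in> borel_measurable borel"
  using assms by (subst borel_measurable_restrict_space_iff_ennreal[symmetric])
    (auto simp: upper_gradient_def)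

text \<open>Half of the coarea formula: the positive and the negative part of an approximating function
  have upper gradients supported on disjoint sets.\<close>

lemma total_variation_pos_neg_part:
  fixes \<mu> :: "'a::complete_space set \<Rightarrow> ennreal"
  assumes reg: "borel_regular_outer_measure \<mu>" and dbl: "doubling \<mu>" and U: "open U"
  shows "total_variation \<mu> U (\<lambda>x. max (u x) 0) + total_variation \<mu> U (\<lambda>x. max (- u x) 0)
    \<le> total_variation \<mu> U u"
proof (rule total_variation_greatest)
  fix v g assume vg: "\<And>i. lip_loc U (v i)" "L1_loc_tendsto \<mu> U v u"
    "\<And>i. upper_gradient U (g i) (\<lambda>x. ereal (v i x))"
  let ?M = "caratheodory_measure \<mu>"
  define gp where "gp i x = g i x * indicator {x. 0 < v i x} x" for i x
  define gn where "gn i x = g i x * indicator {x. 0 < - v i x} x" for i x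
  have cont: "continuous_on U (v i)" for i
    by (rule continuous_on_lip_loc[OF reg dbl U vg(1)])
  have p: "upper_gradient U (gp i) (\<lambda>x. ereal (max (v i x) 0))" for i
    unfolding gp_def[abs_def] by (rule upper_gradient_pos_part[OF cont vg(3)])
  have "upper_gradient U (g i) (\<lambda>x. ereal (- v i x))" for i
    by (rule upper_gradient_lipschitz_comp[OF vg(3)]) auto
  then have n: "upper_gradient U (gn i) (\<lambda>x. ereal (max (- v i x) 0))" for i
    unfolding gn_def[abs_def] by (intro upper_gradient_pos_part continuous_on_minus cont)
  have "total_variation \<mu> U (\<lambda>x. max (u x) 0) \<le> liminf (\<lambda>i. \<integral>\<^sup>+ x \<in> U. gp i x \<partial>?M)"
    by (rule total_variation_le[OF _ _ p])
      (auto intro!: lip_loc_lipschitz_comp[OF vg(1), where f = "\<lambda>a. max a 0"]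
        L1_loc_tendsto_lipschitz_comp[OF vg(2), where f = "\<lambda>a. max a 0"])
  moreover have "total_variation \<mu> U (\<lambda>x. max (- u x) 0) \<le> liminf (\<lambda>i. \<integral>\<^sup>+ x \<in> U. gn i x \<partial>?M)"
    by (rule total_variation_le[OF _ _ n])
      (auto intro!: lip_loc_lipschitz_comp[OF vg(1), where f = "\<lambda>a. max (- a) 0"]
        L1_loc_tendsto_lipschitz_comp[OF vg(2), where f = "\<lambda>a. max (- a) 0"])
  ultimately have "total_variation \<mu> U (\<lambda>x. max (u x) 0) + total_variation \<mu> U (\<lambda>x. max (- u x) 0)
    \<le> liminf (\<lambda>i. \<integral>\<^sup>+ x \<in> U. gp i x \<partial>?M) + liminf (\<lambda>i. \<integral>\<^sup>+ x \<in> U. gn i x \<partial>?M)"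
    by (rule add_mono)
  also have "\<dots> \<le> liminf (\<lambda>i. (\<integral>\<^sup>+ x \<in> U. gp i x \<partial>?M) + (\<integral>\<^sup>+ x \<in> U. gn i x \<partial>?M))"
    by (rule liminf_add_ennreal)
  also have "\<dots> \<le> liminf (\<lambda>i. \<integral>\<^sup>+ x \<in> U. g i x \<partial>?M)"
  proof (intro Liminf_mono always_eventually allI)
    fix i
    have "(\<integral>\<^sup>+ x \<in> U. gp i x \<partial>?M) + (\<integral>\<^sup>+ x \<in> U. gn i x \<partial>?M) =
      (\<integral>\<^sup>+ x. gp i x * indicator U x + gn i x * indicator U x \<partial>?M)"
      by (intro nn_integral_add[symmetric] borel_measurable_caratheodory_measure[OF reg]
        upper_gradient_borel[OF U p] upper_gradient_borel[OF U n])
    also have "\<dots> \<le> (\<integral>\<^sup>+ x \<in> U. g i x \<partial>?M)"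
      by (intro nn_integral_mono) (auto simp: gp_def gn_def split: split_indicator)
    finally show "(\<integral>\<^sup>+ x \<in> U. gp i x \<partial>?M) + (\<integral>\<^sup>+ x \<in> U. gn i x \<partial>?M) \<le> (\<integral>\<^sup>+ x \<in> U. g i x \<partial>?M)" .
  qed
  finally show "total_variation \<mu> U (\<lambda>x. max (u x) 0) + total_variation \<mu> U (\<lambda>x. max (- u x) 0)
    \<le> liminf (\<lambda>i. \<integral>\<^sup>+ x \<in> U. g i x \<partial>?M)" .
qed

text \<open>No measurability is needed, since \<^const>\<open>nn_integral\<close> is a supremum over simple functions from
  below.\<close>

lemma nn_integral_superadd:
  "(\<integral>\<^sup>+ x. f x \<partial>M) + (\<integral>\<^sup>+ x. g x \<partial>M) \<le> (\<integral>\<^sup>+ x. f x + g x \<partial>M)"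
proof -
  let ?S = "\<lambda>f. {s. simple_function M s \<and> s \<le> f}"
  have ne: "?S h \<noteq> {}" for h :: "'a \<Rightarrow> ennreal"
    by (auto intro!: exI[of _ "\<lambda>_. 0"] simp: le_fun_def)
  have "integral\<^sup>S M s + integral\<^sup>S M t \<le> (\<integral>\<^sup>+ x. f x + g x \<partial>M)" if "s \<in> ?S f" "t \<in> ?S g" for s t
  proof -
    have "integral\<^sup>S M s + integral\<^sup>S M t = integral\<^sup>S M (\<lambda>x. s x + t x)"
      using that by (simp add: simple_integral_add)
    also have "\<dots> \<le> (\<integral>\<^sup>+ x. f x + g x \<partial>M)"
      unfolding nn_integral_def using that
      by (intro SUP_upper) (auto simp: le_fun_def intro!: add_mono)
    finally show ?thesis .
  qed
  then have "(\<integral>\<^sup>+ x. f x \<partial>M) + integral\<^sup>S M t \<le> (\<integral>\<^sup>+ x. f x + g x \<partial>M)" if "t \<in> ?S g" for t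
    unfolding nn_integral_def[of M f] using that
    by (subst ennreal_SUP_add_left[OF ne, symmetric]) (blast intro: SUP_least)
  then show ?thesis
    unfolding nn_integral_def[of M g]
    by (subst ennreal_SUP_add_right[OF ne]) (blast intro: SUP_least)
qed

section \<open>Subadditivity of the total variation\<close>

lemma upper_gradient_add:
  assumes g: "upper_gradient U g (\<lambda>x. ereal (u x))" and h: "upper_gradient U h (\<lambda>x. ereal (v x))"
  shows "upper_gradient U (\<lambda>x. g x + h x) (\<lambda>x. ereal (u x + v x))"
  unfolding upper_gradient_def
proof (intro conjI allI impI)
  show "(\<lambda>x. g x + h x) \<in> borel_measurable (restrict_space borel U)"
    using g h by (auto simp: upper_gradient_def)
  fix \<gamma> :: "real \<Rightarrow> 'a"
  assume \<gamma>: "rectifiable_curve \<gamma> \<and> path_image \<gamma> \<subseteq> U \<and> \<not> \<gamma> constant_on {0..1}"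
  let ?x = "pathstart \<gamma>" and ?y = "pathfinish \<gamma>"
  have "ennreal \<bar>(u ?x + v ?x) - (u ?y + v ?y)\<bar> \<le> ennreal (\<bar>u ?x - u ?y\<bar> + \<bar>v ?x - v ?y\<bar>)"
    by (rule ennreal_leI) linarith
  also have "\<dots> = ennreal \<bar>u ?x - u ?y\<bar> + ennreal \<bar>v ?x - v ?y\<bar>"
    by (rule ennreal_plus) auto
  also have "\<dots> \<le> line_integral g \<gamma> + line_integral h \<gamma>"
    using g h \<gamma> by (intro add_mono) (auto simp: upper_gradient_def)
  \<comment> \<open>The direction wanted here is superadditivity, so measurability along the curve
    need not be discussed.\<close>
  also have "\<dots> \<le> line_integral (\<lambda>x. g x + h x) \<gamma>"
    unfolding line_integral_def by (simp add: distrib_right nn_integral_superadd)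
  finally show "e2ennreal \<bar>ereal (u ?x + v ?x) - ereal (u ?y + v ?y)\<bar> \<le> line_integral (\<lambda>x. g x + h x) \<gamma>"
    by simp
qed

lemma lip_loc_add:
  fixes u v :: "'a::metric_space \<Rightarrow> real"
  assumes "lip_loc U u" "lip_loc U v"
  shows "lip_loc U (\<lambda>x. u x + v x)"
  using assms lipschitz_on_add unfolding lip_loc_def by blast

text \<open>\<open>nn_integral\<close> is a lower integral and subadditive only for measurable
  integrands. Hence \<open>u\<close> and \<open>z\<close> are assumed measurable, while the
  approximations are continuous on each \<open>V\<close>.\<close>

lemma L1_loc_tendsto_add:
  assumes reg: "borel_regular_outer_measure \<mu>"
    and lip: "\<And>i. lip_loc U (v i)" "\<And>i. lip_loc U (w i)"
    and meas: "set_borel_measurable (caratheodory_measure \<mu>) U u"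
      "set_borel_measurable (caratheodory_measure \<mu>) U z"
    and lim: "L1_loc_tendsto \<mu> U v u" "L1_loc_tendsto \<mu> U w z"
  shows "L1_loc_tendsto \<mu> U (\<lambda>i x. v i x + w i x) (\<lambda>x. u x + z x)"
  unfolding L1_loc_tendsto_def
proof (intro allI impI)
  fix V assume V: "compactly_inside V U"
  then have "open V" "V \<subseteq> U" by (auto simp: compactly_inside_def intro: compactly_inside_subset[OF V, THEN subsetD])
  let ?M = "caratheodory_measure \<mu>"
  have Vs: "V \<in> sets ?M" using \<open>open V\<close> by (intro borel_in_sets_caratheodory_measure[OF reg]) simp
  have diff: "(\<lambda>x. ennreal \<bar>f x - k x\<bar> * indicator V x) \<in> borel_measurable ?M"
    if f: "lip_loc U f" and k: "set_borel_measurable ?M U k" for f k :: "'a \<Rightarrow> real"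
  proof -
    obtain C where "C-lipschitz_on V f" using V f by (auto simp: lip_loc_def)
    then have "continuous_on V f" by (rule lipschitz_on_continuous_on)
    then have "(\<lambda>x. indicator V x *\<^sub>R f x) \<in> borel_measurable borel"
      using \<open>open V\<close> by (intro borel_measurable_continuous_on_indicator) auto
    then have [measurable]: "(\<lambda>x. indicator V x *\<^sub>R f x) \<in> borel_measurable ?M"
      by (rule borel_measurable_caratheodory_measure[OF reg])
    have [measurable]: "(\<lambda>x. indicator V x *\<^sub>R k x) \<in> borel_measurable ?M"
      using set_borel_measurable_subset[OF k Vs \<open>V \<subseteq> U\<close>] by (simp add: set_borel_measurable_def)
    have "(\<lambda>x. ennreal \<bar>indicator V x *\<^sub>R f x - indicator V x *\<^sub>R k x\<bar>) \<in> borel_measurable ?M"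
      by measurable
    also have "(\<lambda>x. ennreal \<bar>indicator V x *\<^sub>R f x - indicator V x *\<^sub>R k x\<bar>) =
      (\<lambda>x. ennreal \<bar>f x - k x\<bar> * indicator V x)"
      by (auto split: split_indicator)
    finally show ?thesis .
  qed
  have "(\<lambda>i. (\<integral>\<^sup>+ x \<in> V. ennreal \<bar>v i x - u x\<bar> \<partial>?M) + (\<integral>\<^sup>+ x \<in> V. ennreal \<bar>w i x - z x\<bar> \<partial>?M))
    \<longlonglongrightarrow> 0 + 0"
    using lim V by (intro tendsto_add) (auto simp: L1_loc_tendsto_def)
  then have lim0: "(\<lambda>i. (\<integral>\<^sup>+ x \<in> V. ennreal \<bar>v i x - u x\<bar> \<partial>?M) + (\<integral>\<^sup>+ x \<in> V. ennreal \<bar>w i x - z x\<bar> \<partial>?M))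
    \<longlonglongrightarrow> 0" by simp
  have le: "(\<integral>\<^sup>+ x \<in> V. ennreal \<bar>v i x + w i x - (u x + z x)\<bar> \<partial>?M)
    \<le> (\<integral>\<^sup>+ x \<in> V. ennreal \<bar>v i x - u x\<bar> \<partial>?M) + (\<integral>\<^sup>+ x \<in> V. ennreal \<bar>w i x - z x\<bar> \<partial>?M)" for i
  proof -
    have "(\<integral>\<^sup>+ x \<in> V. ennreal \<bar>v i x + w i x - (u x + z x)\<bar> \<partial>?M) \<le>
      (\<integral>\<^sup>+ x. ennreal \<bar>v i x - u x\<bar> * indicator V x + ennreal \<bar>w i x - z x\<bar> * indicator V x \<partial>?M)"
      by (intro nn_integral_mono)
        (auto simp: ennreal_plus[symmetric] simp del: ennreal_plus intro!: ennreal_leI split: split_indicator)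
    also have "\<dots> = (\<integral>\<^sup>+ x \<in> V. ennreal \<bar>v i x - u x\<bar> \<partial>?M) + (\<integral>\<^sup>+ x \<in> V. ennreal \<bar>w i x - z x\<bar> \<partial>?M)"
      by (intro nn_integral_add diff lip meas)
    finally show ?thesis .
  qed
  show "(\<lambda>i. \<integral>\<^sup>+ x \<in> V. ennreal \<bar>v i x + w i x - (u x + z x)\<bar> \<partial>?M) \<longlonglongrightarrow> 0"
    by (rule tendsto_sandwich[OF always_eventually always_eventually tendsto_const lim0])
      (use le in auto)
qed

lemma L1_loc_tendsto_subseq:
  assumes "L1_loc_tendsto \<mu> U v u" "strict_mono r"
  shows "L1_loc_tendsto \<mu> U (\<lambda>i. v (r i)) u"
  unfolding L1_loc_tendsto_def
proof (intro allI impI)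
  fix V assume "compactly_inside V U"
  then have "(\<lambda>i. \<integral>\<^sup>+ x \<in> V. ennreal \<bar>v i x - u x\<bar> \<partial>caratheodory_measure \<mu>) \<longlonglongrightarrow> 0"
    using assms(1) by (simp add: L1_loc_tendsto_def)
  from LIMSEQ_subseq_LIMSEQ[OF this assms(2)]
  show "(\<lambda>i. \<integral>\<^sup>+ x \<in> V. ennreal \<bar>v (r i) x - u x\<bar> \<partial>caratheodory_measure \<mu>) \<longlonglongrightarrow> 0"
    by (simp add: comp_def)
qed

text \<open>The inferior limit is superadditive, which is the wrong direction. Both sequences are
  therefore thinned out, independently, until their energies converge; local convergence in L1
  survives this.\<close>

lemma total_variation_add:
  assumes reg: "borel_regular_outer_measure \<mu>" and U: "open U"
    and meas: "set_borel_measurable (caratheodory_measure \<mu>) U u"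
      "set_borel_measurable (caratheodory_measure \<mu>) U z"
  shows "total_variation \<mu> U (\<lambda>x. u x + z x) \<le> total_variation \<mu> U u + total_variation \<mu> U z"
proof (rule ennreal_le_epsilon)
  fix e :: real
  assume fin: "total_variation \<mu> U u + total_variation \<mu> U z < top" and "0 < e"
  let ?M = "caratheodory_measure \<mu>"
  have "total_variation \<mu> U u < total_variation \<mu> U u + ennreal (e / 2)"
    using fin \<open>0 < e\<close> by (simp add: less_top)
  then obtain v g where v: "\<And>i. lip_loc U (v i)" "L1_loc_tendsto \<mu> U v u"
    "\<And>i. upper_gradient U (g i) (\<lambda>x. ereal (v i x))"
    "liminf (\<lambda>i. \<integral>\<^sup>+ x \<in> U. g i x \<partial>?M) < total_variation \<mu> U u + ennreal (e / 2)"
    by (rule total_variation_lessE) blast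
  have "total_variation \<mu> U z < total_variation \<mu> U z + ennreal (e / 2)"
    using fin \<open>0 < e\<close> by (simp add: less_top)
  then obtain w h where w: "\<And>i. lip_loc U (w i)" "L1_loc_tendsto \<mu> U w z"
    "\<And>i. upper_gradient U (h i) (\<lambda>x. ereal (w i x))"
    "liminf (\<lambda>i. \<integral>\<^sup>+ x \<in> U. h i x \<partial>?M) < total_variation \<mu> U z + ennreal (e / 2)"
    by (rule total_variation_lessE) blast
  obtain r where r: "strict_mono r"
    "((\<lambda>i. \<integral>\<^sup>+ x \<in> U. g i x \<partial>?M) \<circ> r) \<longlonglongrightarrow> liminf (\<lambda>i. \<integral>\<^sup>+ x \<in> U. g i x \<partial>?M)"
    using liminf_subseq_lim by blast
  obtain q where q: "strict_mono q"
    "((\<lambda>i. \<integral>\<^sup>+ x \<in> U. h i x \<partial>?M) \<circ> q) \<longlonglongrightarrow> liminf (\<lambda>i. \<integral>\<^sup>+ x \<in> U. h i x \<partial>?M)"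
    using liminf_subseq_lim by blast
  have int: "(\<integral>\<^sup>+ x \<in> U. g (r i) x + h (q i) x \<partial>?M) = (\<integral>\<^sup>+ x \<in> U. g (r i) x \<partial>?M) + (\<integral>\<^sup>+ x \<in> U. h (q i) x \<partial>?M)" for i
    unfolding distrib_right
    by (intro nn_integral_add borel_measurable_caratheodory_measure[OF reg]
      upper_gradient_borel[OF U v(3)] upper_gradient_borel[OF U w(3)])
  have "(\<lambda>i. \<integral>\<^sup>+ x \<in> U. g (r i) x + h (q i) x \<partial>?M) \<longlonglongrightarrow>
    liminf (\<lambda>i. \<integral>\<^sup>+ x \<in> U. g i x \<partial>?M) + liminf (\<lambda>i. \<integral>\<^sup>+ x \<in> U. h i x \<partial>?M)"
    unfolding int using r(2) q(2) by (intro tendsto_add) (simp_all add: comp_def)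
  then have lim: "liminf (\<lambda>i. \<integral>\<^sup>+ x \<in> U. g (r i) x + h (q i) x \<partial>?M) =
    liminf (\<lambda>i. \<integral>\<^sup>+ x \<in> U. g i x \<partial>?M) + liminf (\<lambda>i. \<integral>\<^sup>+ x \<in> U. h i x \<partial>?M)"
    by (intro lim_imp_Liminf) simp_all
  have "total_variation \<mu> U (\<lambda>x. u x + z x) \<le> liminf (\<lambda>i. \<integral>\<^sup>+ x \<in> U. g (r i) x + h (q i) x \<partial>?M)"
    by (rule total_variation_le[where v = "\<lambda>i x. v (r i) x + w (q i) x"])
      (intro lip_loc_add upper_gradient_add v w
        L1_loc_tendsto_add[OF reg] meas L1_loc_tendsto_subseq r q)+
  also have "\<dots> \<le> (total_variation \<mu> U u + ennreal (e / 2)) + (total_variation \<mu> U z + ennreal (e / 2))"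
    unfolding lim using v(4) w(4) by (intro add_mono less_imp_le)
  also have "\<dots> = (total_variation \<mu> U u + total_variation \<mu> U z) + (ennreal (e / 2) + ennreal (e / 2))"
    by (simp only: ac_simps)
  also have "ennreal (e / 2) + ennreal (e / 2) = ennreal e"
    using \<open>0 < e\<close> by (subst ennreal_plus[symmetric]) auto
  finally show "total_variation \<mu> U (\<lambda>x. u x + z x)
    \<le> total_variation \<mu> U u + total_variation \<mu> U z + ennreal e" .
qed

section \<open>The restricted Neumann problem\<close>

text \<open>Small balls about an interior point miss the complement, so one density is eventually 0.
  This separates the points where traces are taken from a compact set on which a competitor
  differs.\<close>

lemma mt_boundary_disjoint_open:
  assumes reg: "borel_regular_outer_measure \<mu>" and "open \<Omega>" "x \<in> \<Omega>"
  shows "x \<notin> mt_boundary \<mu> \<Omega>"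
proof -
  have "\<mu> {} = 0"
    using reg by (simp add: borel_regular_outer_measure_def outer_measure_space_def positive_def)
  obtain e where e: "0 < e" "ball x e \<subseteq> \<Omega>"
    using assms(2,3) open_contains_ball by blast
  have "\<mu> (ball x r - \<Omega>) / \<mu> (ball x r) = 0" if "r < e" for r
  proof -
    have empty: "ball x r - \<Omega> = {}" using that e by auto
    show ?thesis unfolding empty using \<open>\<mu> {} = 0\<close> by simp
  qed
  then have "\<forall>\<^sub>F r in at_right 0. \<mu> (ball x r - \<Omega>) / \<mu> (ball x r) = 0"
    using e(1) by (auto simp: eventually_at_right_field)
  then have "Limsup (at_right 0) (\<lambda>r. \<mu> (ball x r - \<Omega>) / \<mu> (ball x r)) = Limsup (at_right (0::real)) (\<lambda>r. 0)"
    by (rule Limsup_eq)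
  then show ?thesis by (simp add: mt_boundary_def Limsup_const)
qed

text \<open>Only small radii matter in \<open>has_trace\<close>, so the predicates for
  \<open>u\<close> and \<open>v\<close> agree for every \<open>T\<close>, and with them the values
  of \<open>THE\<close>, whether or not a trace exists.\<close>

lemma trace_cong_near:
  assumes "closed K" "x \<notin> K" and eq: "\<And>y. y \<in> \<Omega> - K \<Longrightarrow> u y = v y"
  shows "trace \<mu> \<Omega> u x = trace \<mu> \<Omega> v x"
proof -
  obtain e where e: "0 < e" "ball x e \<inter> K = {}"
    using assms(1,2) open_contains_ball[of "- K"] by (auto simp: disjoint_eq_subset_Compl)
  have "(\<integral>\<^sup>+ y \<in> ball x r \<inter> \<Omega>. ennreal \<bar>u y - T\<bar> \<partial>caratheodory_measure \<mu>) / \<mu> (ball x r \<inter> \<Omega>)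
    = (\<integral>\<^sup>+ y \<in> ball x r \<inter> \<Omega>. ennreal \<bar>v y - T\<bar> \<partial>caratheodory_measure \<mu>) / \<mu> (ball x r \<inter> \<Omega>)"
    if "r < e" for r T
  proof -
    have "u y = v y" if "y \<in> ball x r \<inter> \<Omega>" for y
      using that \<open>r < e\<close> e(2) by (intro eq) (auto simp: disjoint_iff)
    then show ?thesis
      by (intro arg_cong2[where f = "(/)"] nn_integral_cong refl) (auto split: split_indicator)
  qed
  then have "\<forall>\<^sub>F r in at_right 0.
    (\<integral>\<^sup>+ y \<in> ball x r \<inter> \<Omega>. ennreal \<bar>u y - T\<bar> \<partial>caratheodory_measure \<mu>) / \<mu> (ball x r \<inter> \<Omega>)
    = (\<integral>\<^sup>+ y \<in> ball x r \<inter> \<Omega>. ennreal \<bar>v y - T\<bar> \<partial>caratheodory_measure \<mu>) / \<mu> (ball x r \<inter> \<Omega>)" for T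
    using e(1) unfolding eventually_at_right_field by blast
  then have "has_trace \<mu> \<Omega> u x T \<longleftrightarrow> has_trace \<mu> \<Omega> v x T" for T
    unfolding has_trace_def by (rule tendsto_cong)
  then show ?thesis by (simp add: trace_def)
qed

text \<open>The boundary integrands coincide, so the boundary terms cancel. Finiteness matters
  because \<open>enn2real\<close> sends infinity to 0 and would spoil the comparison.\<close>

lemma neumann_functional_le_iff:
  assumes reg: "borel_regular_outer_measure \<mu>" and \<Omega>: "open \<Omega>"
    and K: "closed K" "K \<subseteq> \<Omega>" and eq: "\<And>y. y \<in> \<Omega> - K \<Longrightarrow> u y = v y"
    and fin: "total_variation \<mu> \<Omega> u < \<infinity>" "total_variation \<mu> \<Omega> v < \<infinity>"
  shows "neumann_functional \<mu> \<Omega> f u \<le> neumann_functional \<mu> \<Omega> f v \<longleftrightarrow>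
    total_variation \<mu> \<Omega> u \<le> total_variation \<mu> \<Omega> v"
proof -
  have "trace \<mu> \<Omega> u x = trace \<mu> \<Omega> v x" if "x \<in> mt_boundary \<mu> \<Omega>" for x
    using mt_boundary_disjoint_open[OF reg \<Omega>, of x] that K(2)
    by (intro trace_cong_near[OF K(1) _ eq]) auto
  then have "(\<lambda>x. indicator (mt_boundary \<mu> \<Omega>) x *\<^sub>R (trace \<mu> \<Omega> u x * f x)) =
    (\<lambda>x. indicator (mt_boundary \<mu> \<Omega>) x *\<^sub>R (trace \<mu> \<Omega> v x * f x))"
    by (auto split: split_indicator)
  then have "(LINT x:mt_boundary \<mu> \<Omega>|perimeter_measure \<mu> \<Omega>. trace \<mu> \<Omega> u x * f x) =
    (LINT x:mt_boundary \<mu> \<Omega>|perimeter_measure \<mu> \<Omega>. trace \<mu> \<Omega> v x * f x)"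
    unfolding set_lebesgue_integral_def by simp
  then show ?thesis
    using fin by (cases "total_variation \<mu> \<Omega> u"; cases "total_variation \<mu> \<Omega> v")
      (simp_all add: neumann_functional_def)
qed

lemma set_integrable_pos_part:
  fixes u :: "'a \<Rightarrow> real"
  assumes "set_integrable M A u"
  shows "set_integrable M A (\<lambda>x. max (u x) 0)"
proof -
  have "integrable M (\<lambda>x. max (indicator A x *\<^sub>R u x) 0)"
    using assms by (simp add: set_integrable_def)
  also have "(\<lambda>x. max (indicator A x *\<^sub>R u x) 0) = (\<lambda>x. indicator A x *\<^sub>R max (u x) 0)"
    by (auto split: split_indicator)
  finally show ?thesis by (simp add: set_integrable_def)
qed

text \<open>The clamp fixes 0, so it commutes with multiplication by the indicator of
  \<open>A\<close>, and it does not increase absolute values.\<close>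

lemma set_integrable_clamp:
  fixes u :: "'a \<Rightarrow> real"
  assumes "set_integrable M A u"
  shows "set_integrable M A (\<lambda>x. max 0 (min 1 (u x)))"
proof -
  have u: "integrable M (\<lambda>x. indicator A x *\<^sub>R u x)"
    using assms by (simp add: set_integrable_def)
  then have "(\<lambda>x. indicator A x *\<^sub>R u x) \<in> borel_measurable M" by simp
  then have meas: "(\<lambda>x. max 0 (min 1 (indicator A x *\<^sub>R u x))) \<in> borel_measurable M"
    by (intro borel_measurable_max borel_measurable_min borel_measurable_const)
  have "integrable M (\<lambda>x. max 0 (min 1 (indicator A x *\<^sub>R u x)))"
    by (rule Bochner_Integration.integrable_bound[OF u meas]) auto
  also have "(\<lambda>x. max 0 (min 1 (indicator A x *\<^sub>R u x))) = (\<lambda>x. indicator A x *\<^sub>R max 0 (min 1 (u x)))"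
    by (auto split: split_indicator)
  finally show ?thesis by (simp add: set_integrable_def)
qed

text \<open>Minimality is phrased through total variation alone, with a symmetric bound on the
  competitors. This form is invariant under a change of sign, so the lemma also applies with
  \<open>E1\<close> and \<open>E2\<close> exchanged.\<close>

lemma least_gradient_indicator:
  fixes \<mu> :: "'a::complete_space set \<Rightarrow> ennreal" and E1 E2 :: "'a set"
  defines "u \<equiv> \<lambda>x. indicator E1 x - indicator E2 x :: real"
  assumes reg: "borel_regular_outer_measure \<mu>" and dbl: "doubling \<mu>" and \<Omega>: "open \<Omega>"
    and E: "E1 \<inter> E2 = {}" and u: "u \<in> BV \<mu> \<Omega>"
    and min: "\<And>v K. v \<in> BV \<mu> \<Omega> \<Longrightarrow> (\<And>x. x \<in> \<Omega> \<Longrightarrow> \<bar>v x\<bar> \<le> 1) \<Longrightarrow> compact K \<Longrightarrow> K \<subseteq> \<Omega> \<Longrightarrow>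
      (\<And>x. x \<in> \<Omega> - K \<Longrightarrow> u x = v x) \<Longrightarrow> total_variation \<mu> \<Omega> u \<le> total_variation \<mu> \<Omega> v"
  shows "least_gradient \<mu> \<Omega> (indicator E1)"
proof -
  let ?M = "caratheodory_measure \<mu>" and ?TV = "total_variation \<mu> \<Omega>"
  have E1: "(indicator E1 :: 'a \<Rightarrow> real) = (\<lambda>x. max (u x) 0)"
    and E2: "(indicator E2 :: 'a \<Rightarrow> real) = (\<lambda>x. max (- u x) 0)"
    using E by (auto simp: u_def fun_eq_iff split: split_indicator)
  have iu: "set_integrable ?M \<Omega> u" using u by (simp add: BV_def L1_on_def)
  have i1: "set_integrable ?M \<Omega> (indicator E1 :: 'a \<Rightarrow> real)"
    unfolding E1 by (rule set_integrable_pos_part[OF iu])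
  have i2: "set_integrable ?M \<Omega> (indicator E2 :: 'a \<Rightarrow> real)"
    unfolding E2 using iu by (intro set_integrable_pos_part) (simp add: set_integrable_def)
  have split: "?TV (indicator E1) + ?TV (indicator E2) \<le> ?TV u"
    unfolding E1 E2 by (rule total_variation_pos_neg_part[OF reg dbl \<Omega>])
  have "?TV u < \<infinity>" using u by (simp add: BV_def)
  \<comment> \<open>Both variations are finite because \<open>split\<close> bounds their sum by that
    of \<open>u\<close>. This gives membership in \<open>BV_loc\<close> and permits the cancellation
    in \<open>ennreal\<close> at the end.\<close>
  then have "?TV (indicator E1) + ?TV (indicator E2) < \<infinity>"
    using split by (rule order.strict_trans1[rotated])
  then have fin: "?TV (indicator E1) < \<infinity>" "?TV (indicator E2) < \<infinity>"
    by simp_all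
  have meas: "set_borel_measurable ?M \<Omega> w" if "set_integrable ?M \<Omega> w" for w :: "'a \<Rightarrow> real"
    using that by (auto simp: set_integrable_def set_borel_measurable_def)
  show ?thesis
    unfolding least_gradient_def
  proof (intro conjI ballI impI)
    show "indicator E1 \<in> BV_loc \<mu> \<Omega>"
      unfolding BV_loc_def
    proof (intro CollectI allI impI)
      fix V assume V: "compactly_inside V \<Omega>"
      then have "V \<subseteq> \<Omega>" "V \<in> sets ?M"
        by (auto intro: compactly_inside_subset[THEN subsetD] borel_in_sets_caratheodory_measure[OF reg]
            simp: compactly_inside_def)
      then have "set_integrable ?M V (indicator E1 :: 'a \<Rightarrow> real)"
        using i1 by (blast intro: set_integrable_subset)
      moreover have "total_variation \<mu> V (indicator E1) < \<infinity>"
        using total_variation_mono[OF \<open>V \<subseteq> \<Omega>\<close>] fin(1) by (rule order.strict_trans1)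
      ultimately show "indicator E1 \<in> BV \<mu> V" by (simp add: BV_def L1_on_def)
    qed
    fix \<phi>
    assume \<phi>: "\<phi> \<in> BV \<mu> \<Omega>"
      and K: "compact (closure {x \<in> \<Omega>. \<phi> x \<noteq> 0}) \<and> closure {x \<in> \<Omega>. \<phi> x \<noteq> 0} \<subseteq> \<Omega>"
    define w where "w x = indicator E1 x + \<phi> x" for x
    define t where "t x = max 0 (min 1 (w x))" for x
    define v where "v x = t x - indicator E2 x" for x
    have i\<phi>: "set_integrable ?M \<Omega> \<phi>" and "?TV \<phi> < \<infinity>" using \<phi> by (auto simp: BV_def L1_on_def)
    have "set_integrable ?M \<Omega> w"
      unfolding w_def[abs_def] using i1 i\<phi> by (rule set_integral_add)
    then have it: "set_integrable ?M \<Omega> t"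
      unfolding t_def[abs_def] by (rule set_integrable_clamp)
    have iv: "set_integrable ?M \<Omega> v"
      unfolding v_def[abs_def] using it i2 by (rule set_integral_diff)
    have t_le: "?TV t \<le> ?TV w"
      by (rule total_variation_lipschitz_comp[where f = "\<lambda>a. max 0 (min 1 a)"]) (auto simp: t_def)
    have i2': "set_integrable ?M \<Omega> (\<lambda>x. - indicator E2 x :: real)"
      using i2 by (simp add: set_integrable_def)
    have "v = (\<lambda>x. t x + - indicator E2 x)" by (simp add: v_def fun_eq_iff)
    then have v_le: "?TV v \<le> ?TV t + ?TV (indicator E2)"
      using total_variation_add[OF reg \<Omega> meas[OF it] meas[OF i2']]
        total_variation_uminus[of \<mu> \<Omega> "indicator E2"] by simp
    \<comment> \<open>Finiteness of \<open>?TV w\<close> passes through \<open>t_le\<close> and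
      \<open>v_le\<close> to \<open>v\<close>, which thereby becomes an admissible competitor in
      \<open>BV\<close>.\<close>
    have "?TV w \<le> ?TV (indicator E1) + ?TV \<phi>"
      unfolding w_def[abs_def] by (rule total_variation_add[OF reg \<Omega> meas[OF i1] meas[OF i\<phi>]])
    also have "\<dots> < \<infinity>" using fin \<open>?TV \<phi> < \<infinity>\<close> by simp
    finally have "?TV t + ?TV (indicator E2) < \<infinity>"
      using t_le fin by (auto intro: order.strict_trans1)
    then have "?TV v < \<infinity>" using v_le by (rule order.strict_trans1[rotated])
    \<comment> \<open>Off the closure of its support \<open>\<phi>\<close> vanishes, so the clamp
      acts on the indicator of \<open>E1\<close> and leaves it unchanged; hence \<open>v\<close>
      equals \<open>u\<close> there.\<close>
    then have "?TV u \<le> ?TV v"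
      using iv K
      by (intro min[of v "closure {x \<in> \<Omega>. \<phi> x \<noteq> 0}"])
        (auto simp: BV_def L1_on_def v_def t_def w_def u_def split: split_indicator
          dest: contra_subsetD[OF closure_subset])
    then have "?TV (indicator E1) + ?TV (indicator E2) \<le> ?TV w + ?TV (indicator E2)"
      using split v_le add_right_mono[OF t_le, of "?TV (indicator E2)"] by order
    then have "?TV (indicator E1) \<le> ?TV w"
      using fin(2) by (auto simp: ennreal_add_left_cancel_le add.commute[of _ "?TV (indicator E2)"])
    then show "?TV (indicator E1) \<le> ?TV (\<lambda>x. indicator E1 x + \<phi> x)"
      by (simp add: w_def[abs_def])
  qed
qed

theorem proposition3p14:
  fixes \<mu> :: "'a::complete_space set \<Rightarrow> ennreal"
    and \<Omega> E1 E2 :: "'a set"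
    and f :: "'a \<Rightarrow> real"
  assumes "\<exists>x y :: 'a. x \<noteq> y"
    and "borel_regular_outer_measure \<mu>"
    and "doubling \<mu>"
    and "poincare_1_1 \<mu>"
    and "\<Omega> \<noteq> {}" and "bounded \<Omega>" and "open \<Omega>"
    and "perimeter \<mu> \<Omega> UNIV < \<infinity>"
    and "\<And>u. u \<in> BV \<mu> \<Omega> \<Longrightarrow>
           codim1_hausdorff \<mu> {x \<in> mt_boundary \<mu> \<Omega>. \<nexists>T. has_trace \<mu> \<Omega> u x T} = 0"
    and "set_integrable (perimeter_measure \<mu> \<Omega>) (mt_boundary \<mu> \<Omega>) f"
    and "(LINT x:mt_boundary \<mu> \<Omega>|perimeter_measure \<mu> \<Omega>. f x) = 0"
    and "E1 \<subseteq> \<Omega>" and "E2 \<subseteq> \<Omega>" and "E1 \<inter> E2 = {}"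
    and "solves_restricted_neumann \<mu> \<Omega> f (\<lambda>x. indicator E1 x - indicator E2 x)"
  shows "least_gradient \<mu> \<Omega> (indicator E1) \<and> least_gradient \<mu> \<Omega> (indicator E2)"
proof -
  note reg = assms(2) and dbl = assms(3) and \<Omega> = assms(7) and disj = assms(14)
  define u :: "'a \<Rightarrow> real" where "u x = indicator E1 x - indicator E2 x" for x
  have u: "u \<in> BV \<mu> \<Omega>"
    and sol: "\<And>v. v \<in> BV \<mu> \<Omega> \<Longrightarrow> (\<And>x. x \<in> \<Omega> \<Longrightarrow> \<bar>v x\<bar> \<le> 1) \<Longrightarrow>
      neumann_functional \<mu> \<Omega> f u \<le> neumann_functional \<mu> \<Omega> f v"
    using assms(15) by (auto simp: solves_restricted_neumann_def u_def[abs_def] abs_le_iff)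
  have min: "total_variation \<mu> \<Omega> u \<le> total_variation \<mu> \<Omega> v"
    if "v \<in> BV \<mu> \<Omega>" "\<And>x. x \<in> \<Omega> \<Longrightarrow> \<bar>v x\<bar> \<le> 1" "compact K" "K \<subseteq> \<Omega>"
      "\<And>x. x \<in> \<Omega> - K \<Longrightarrow> u x = v x" for v K
  proof -
    have "neumann_functional \<mu> \<Omega> f u \<le> neumann_functional \<mu> \<Omega> f v"
      using that by (intro sol)
    then show ?thesis
      using neumann_functional_le_iff[OF reg \<Omega> compact_imp_closed[OF that(3)] that(4,5)] u that(1)
      by (simp add: BV_def)
  qed
  have uminus: "(\<lambda>x. - v x) \<in> BV \<mu> \<Omega>" if "v \<in> BV \<mu> \<Omega>" for v
    using that by (simp add: BV_def L1_on_def set_integrable_def total_variation_uminus)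
  have neg: "indicator E2 x - indicator E1 x = - u x" for x
    by (simp add: u_def)
  have "least_gradient \<mu> \<Omega> (indicator E1)"
    using u min unfolding u_def[abs_def] by (rule least_gradient_indicator[OF reg dbl \<Omega> disj])
  moreover have "least_gradient \<mu> \<Omega> (indicator E2)"
  proof (rule least_gradient_indicator[OF reg dbl \<Omega>, of E2 E1]; (unfold neg)?)
    show "E2 \<inter> E1 = {}" using disj by blast
    show "(\<lambda>x. - u x) \<in> BV \<mu> \<Omega>" by (rule uminus[OF u])
    fix v K
    assume v: "v \<in> BV \<mu> \<Omega>" "\<And>x. x \<in> \<Omega> \<Longrightarrow> \<bar>v x\<bar> \<le> 1" "compact K" "K \<subseteq> \<Omega>"
      "\<And>x. x \<in> \<Omega> - K \<Longrightarrow> - u x = v x"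
    \<comment> \<open>A competitor \<open>v\<close> for \<open>- u\<close> is turned into the
      competitor \<open>- v\<close> for \<open>u\<close>.\<close>
    have "total_variation \<mu> \<Omega> u \<le> total_variation \<mu> \<Omega> (\<lambda>x. - v x)"
      using v uminus[OF v(1)] by (intro min[of _ K]) (auto simp: minus_equation_iff[of "u _"])
    then show "total_variation \<mu> \<Omega> (\<lambda>x. - u x) \<le> total_variation \<mu> \<Omega> v"
      by (simp add: total_variation_uminus)
  qed
  ultimately show ?thesis by blast
qed

end
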